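(* Let $w\in\tilde W$ have length $\ell$. (1) For any reduced word $\mathbf i=i_1\cdots i_\ell$ of $w$, the map $e_{\mathbf i}:\mathbb R_{>0}^\ell\to E_w$, $(a_1,\dots,a_\ell)\mapsto e_{i_1}(a_1)\cdots e_{i_\ell}(a_\ell)$, is injective. (2) Let $X\in E_w$ and suppose $X=YZ$ with $Y,Z$ totally nonnegative elements of $U$. Then $Y\in E_v$ and $Z\in E_u$ for some $v,u\in\tilde W$, and $v\le w$ in right weak order.
   Context: Elements of $GL_n(\mathbb R((t)))$ are identified with their unfoldings: $\mathbb Z\times\mathbb Z$ real matrices $(x_{i,j})$ with $x_{i+n,j+n}=x_{i,j}$ and $a_{ij}(t)=\sum_k x_{i,j+kn}t^k$. $U$ is the group of upper-triangular unipotent elements of $GL_n(\mathbb R((t)))$. An element is totally nonnegative if all finite minors of its unfolding are $\ge 0$. For $i\in\mathbb Z/n\mathbb Z$, $e_i(a)\in U$ equals the identity except for entries $a$ at positions $(kn+i,kn+i+1)$, $k\in\mathbb Z$. $\tilde W$ is the affine symmetric group with simple generators $s_i$, $i\in\mathbb Z/n\mathbb Z$. For $w\in\tilde W$ with reduced word $i_1\cdots i_\ell$, set $E_w=\{e_{i_1}(a_1)\cdots e_{i_\ell}(a_\ell): a_k>0\}$; this is independent of the reduced word. Right weak order: $v\le w$ iff $w=vu$ with $\ell(w)=\ell(v)+\ell(u)$. *)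

theory Defs
  imports
    "Jordan_Normal_Form.Determinant"
    "HOL-Computational_Algebra.Formal_Laurent_Series"
begin

section \<open>The loop group and unfoldings\<close>

definition loop_GL :: "nat \<Rightarrow> real fls mat set" where
  "loop_GL n = {A \<in> carrier_mat n n. invertible_mat A}"

text \<open>
  The unfolding of \<open>A = (a\<^sub>i\<^sub>j(t))\<close> is the \<open>\<int> \<times> \<int>\<close> matrix \<open>x\<close> with
  \<open>x (i + n) (j + n) = x i j\<close> and \<open>a\<^sub>i\<^sub>j(t) = (\<Sum>k. x i (j + k n) t\<^sup>k)\<close> for \<open>1 \<le> i, j \<le> n\<close>.
  The matrices of the library have rows and columns indexed from 0, so the entry of \<open>A\<close> at
  position \<open>(p, q)\<close> is \<open>a\<^sub>i\<^sub>j(t)\<close> with \<open>i = p + 1\<close>, \<open>j = q + 1\<close>.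
\<close>

definition unfolding_of :: "nat \<Rightarrow> real fls mat \<Rightarrow> int \<Rightarrow> int \<Rightarrow> real" where
  "unfolding_of n A i j =
     fls_nth (A $$ (nat ((i - 1) mod int n), nat ((j - 1) mod int n)))
             ((j - 1) div int n - (i - 1) div int n)"

text \<open>
  The inverse construction. It is meaningful for periodic \<open>x\<close> such that each \<open>x i j\<close> vanishes for
  all sufficiently negative \<open>j\<close>; otherwise \<open>Abs_fls\<close> is applied outside its domain.
\<close>

definition folding_of :: "nat \<Rightarrow> (int \<Rightarrow> int \<Rightarrow> real) \<Rightarrow> real fls mat" where
  "folding_of n x =
     mat n n (\<lambda>(p, q). Abs_fls (\<lambda>k. x (int p + 1) (int q + 1 + k * int n)))"

text \<open>Upper triangular and unipotent refer to the unfolding (so \<open>A\<close> is upper unitriangular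
  modulo \<open>t\<close>, with entries in \<open>\<real>[[t]]\<close>).\<close>

definition loop_U :: "nat \<Rightarrow> real fls mat set" where
  "loop_U n = {A \<in> loop_GL n.
     (\<forall>i. unfolding_of n A i i = 1) \<and> (\<forall>i j. j < i \<longrightarrow> unfolding_of n A i j = 0)}"

text \<open>The \<open>k \<times> k\<close> minor with rows \<open>I 0 < \<dots> < I (k - 1)\<close> and columns \<open>J 0 < \<dots> < J (k - 1)\<close>.\<close>

definition minor :: "(int \<Rightarrow> int \<Rightarrow> real) \<Rightarrow> nat \<Rightarrow> (nat \<Rightarrow> int) \<Rightarrow> (nat \<Rightarrow> int) \<Rightarrow> real" where
  "minor x k I J = det (mat k k (\<lambda>(p, q). x (I p) (J q)))"

definition totally_nonneg :: "nat \<Rightarrow> real fls mat \<Rightarrow> bool" where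
  "totally_nonneg n A \<longleftrightarrow>
     (\<forall>k I J. strict_mono_on {..<k} I \<longrightarrow> strict_mono_on {..<k} J \<longrightarrow>
        0 \<le> minor (unfolding_of n A) k I J)"

text \<open>Indices in \<open>\<int>/n\<int>\<close> are given by integer representatives.\<close>

definition chevalley :: "nat \<Rightarrow> int \<Rightarrow> real \<Rightarrow> real fls mat" where
  "chevalley n i a = folding_of n
     (\<lambda>p q. if p = q then 1 else if p mod int n = i mod int n \<and> q = p + 1 then a else 0)"

definition chevalley_word :: "nat \<Rightarrow> int list \<Rightarrow> real list \<Rightarrow> real fls mat" where
  "chevalley_word n is as = foldr (*) (map2 (chevalley n) is as) (1\<^sub>m n)"

section \<open>The affine symmetric group\<close>

text \<open>
  The affine symmetric group is realised as the group, under composition, of bijections \<open>w\<close> of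
  the integers with \<open>w (i + n) = w i + n\<close> and \<open>w 1 + \<dots> + w n = 1 + \<dots> + n\<close>.
\<close>

definition affine_sym :: "nat \<Rightarrow> (int \<Rightarrow> int) set" where
  "affine_sym n = {w. bij w \<and> (\<forall>i. w (i + int n) = w i + int n) \<and>
     (\<Sum>i = 1..int n. w i) = (\<Sum>i = 1..int n. i)}"

text \<open>\<open>s\<^sub>i\<close> exchanges \<open>k n + i\<close> and \<open>k n + i + 1\<close> for every integer \<open>k\<close> (here \<open>n \<ge> 2\<close>).\<close>

definition simple_gen :: "nat \<Rightarrow> int \<Rightarrow> int \<Rightarrow> int" where
  "simple_gen n i j =
     (if j mod int n = i mod int n then j + 1
      else if j mod int n = (i + 1) mod int n then j - 1
      else j)"

text \<open>Letters of words, i.e. elements of \<open>\<int>/n\<int>\<close>, are represented by \<open>0, \<dots>, n - 1\<close>.\<close>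

definition is_word :: "nat \<Rightarrow> (int \<Rightarrow> int) \<Rightarrow> int list \<Rightarrow> bool" where
  "is_word n w is \<longleftrightarrow> set is \<subseteq> {0..<int n} \<and> foldr (\<circ>) (map (simple_gen n) is) id = w"

definition aff_length :: "nat \<Rightarrow> (int \<Rightarrow> int) \<Rightarrow> nat" where
  "aff_length n w = (LEAST l. \<exists>is. is_word n w is \<and> length is = l)"

definition reduced_word :: "nat \<Rightarrow> (int \<Rightarrow> int) \<Rightarrow> int list \<Rightarrow> bool" where
  "reduced_word n w is \<longleftrightarrow> is_word n w is \<and> length is = aff_length n w"

definition right_weak_le :: "nat \<Rightarrow> (int \<Rightarrow> int) \<Rightarrow> (int \<Rightarrow> int) \<Rightarrow> bool" where
  "right_weak_le n v w \<longleftrightarrow> v \<in> affine_sym n \<and> w \<in> affine_sym n \<and>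
     (\<exists>u \<in> affine_sym n. w = v \<circ> u \<and> aff_length n w = aff_length n v + aff_length n u)"

section \<open>The cells\<close>

definition pos_tuples :: "nat \<Rightarrow> real list set" where
  "pos_tuples l = {as. length as = l \<and> (\<forall>a \<in> set as. 0 < a)}"

text \<open>
  The image of \<open>chevalley_word n is\<close> on \<open>pos_tuples (length is)\<close> is the same for all reduced words
  of \<open>w\<close>. The union over all reduced words avoids choosing one.
\<close>

definition cell :: "nat \<Rightarrow> (int \<Rightarrow> int) \<Rightarrow> real fls mat set" where
  "cell n w = (\<Union>is \<in> {is. reduced_word n w is}. chevalley_word n is ` pos_tuples (length is))"

end

theory Submission
  imports Defs "HOL-Library.Function_Algebras"
begin

text \<open>
  Cells are built by right multiplication along words whose every letter is an ascent. The
  permutation of a cell can be read off from linear dependencies between truncated columns, so cells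
  are disjoint. If \<open>X e\<^sub>i(a) = X' e\<^sub>i(a')\<close> with \<open>a < a'\<close> and \<open>X\<close>, \<open>X'\<close> in the cell of \<open>v < v s\<^sub>i\<close>, then
  \<open>X = X' e\<^sub>i(a' - a)\<close> would also lie in the cell of \<open>v s\<^sub>i\<close>; hence injectivity. By Matsumoto's theorem, multiplying a cell by a
  positive Chevalley generator stays in the cell or moves up along a cover of the right weak order,
  so part (2) reduces to showing that \<open>Y\<close> and \<open>Z\<close> are products of positive Chevalley generators.
  They are banded, because their entries are dominated by those of \<open>X\<close>, and so are their
  inverses, because \<open>X\<close> has a banded inverse. Such a totally nonnegative matrix is factored by
  Whitney's elimination: two adjacent rows whose supports end in the same column exist unless the
  matrix is the identity.
\<close>

section \<open>Minors and elimination of a row\<close>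

text \<open>The inverse of X has to enter because bandedness alone gives no factorization: for a > 0
  the matrix with 1 on the diagonal and a at every position (i, i + 1) is banded and totally
  nonnegative, but no two adjacent rows end in the same column, and its inverse is not banded. No
  theory of lengths of affine permutations is presupposed. Cells carry a step counter, and letters
  are exchanged for points of cells, that is, for permutations and parameters at once. That all
  chains for v have the same number of steps, that this number is the length, and that letters of
  reduced words are ascents are then consequences. In part (2) the permutation u of Z need not be
  the element t with w = v t: for Y = e_i(a) and Z = e_i(b) one has w = v = u = s_i and t = 1. So
  the word of Z is multiplied onto Y letter by letter, and only the ascents contribute to t.\<close>

lemma det_mat_expand_row:
  fixes f :: "nat \<Rightarrow> nat \<Rightarrow> real"
  assumes "p < Suc k"
  shows "det (mat (Suc k) (Suc k) (\<lambda>(i, j). f i j)) =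
    (\<Sum>j<Suc k. f p j * ((-1) ^ (p + j) *
       det (mat k k (\<lambda>(i', j'). f (insert_index p i') (insert_index j j')))))"
proof -
  have "mat_delete (mat (Suc k) (Suc k) (\<lambda>(i, j). f i j)) p j
      = mat k k (\<lambda>(i', j'). f (insert_index p i') (insert_index j j'))" for j
    by (rule eq_matI) (auto simp: mat_delete_def insert_index_def)
  then show ?thesis
    using laplace_expansion_row[of "mat (Suc k) (Suc k) (\<lambda>(i, j). f i j)" "Suc k" p] assms
    by (simp add: cofactor_def)
qed

lemma det_mat_expand_col:
  fixes f :: "nat \<Rightarrow> nat \<Rightarrow> real"
  assumes "q < Suc k"
  shows "det (mat (Suc k) (Suc k) (\<lambda>(i, j). f i j)) =
    (\<Sum>i<Suc k. f i q * ((-1) ^ (i + q) *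
       det (mat k k (\<lambda>(i', j'). f (insert_index i i') (insert_index q j')))))"
proof -
  have "mat_delete (mat (Suc k) (Suc k) (\<lambda>(i, j). f i j)) i q
      = mat k k (\<lambda>(i', j'). f (insert_index i i') (insert_index q j'))" for i
    by (rule eq_matI) (auto simp: mat_delete_def insert_index_def)
  then show ?thesis
    using laplace_expansion_column[of "mat (Suc k) (Suc k) (\<lambda>(i, j). f i j)" "Suc k" q] assms
    by (simp add: cofactor_def)
qed

lemma det_mat_identical_rows:
  fixes f :: "nat \<Rightarrow> nat \<Rightarrow> real"
  assumes "i \<noteq> j" "i < k" "j < k" "\<And>q. q < k \<Longrightarrow> f i q = f j q"
  shows "det (mat k k (\<lambda>(i, j). f i j)) = 0"
  by (rule det_identical_rows[where i = i and j = j]) (use assms in \<open>auto intro!: eq_vecI\<close>)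

lemma det_mat_identical_cols:
  fixes f :: "nat \<Rightarrow> nat \<Rightarrow> real"
  assumes "i \<noteq> j" "i < k" "j < k" "\<And>p. p < k \<Longrightarrow> f p i = f p j"
  shows "det (mat k k (\<lambda>(i, j). f i j)) = 0"
proof -
  have "det (mat k k (\<lambda>(i, j). f i j)) = det (mat k k (\<lambda>(i, j). f j i))"
    by (subst det_transpose[symmetric, of _ k]) (auto simp: transpose_mat_def intro!: arg_cong[of _ _ det])
  then show ?thesis
    using det_mat_identical_rows[of i j k "\<lambda>i j. f j i"] assms by simp
qed

lemma det_mat_cong:
  assumes "\<And>i j. i < k \<Longrightarrow> j < k \<Longrightarrow> f i j = g i j"
  shows "det (mat k k (\<lambda>(i, j). f i j)) = det (mat k k (\<lambda>(i, j). g i j))"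
  by (intro arg_cong[of _ _ det] eq_matI) (auto simp: assms)

lemma insert_index_lt: "i < k \<Longrightarrow> insert_index p i < Suc k"
  by (simp add: insert_index_def)

text \<open>Repeating column q as an additional last column gives a square matrix of determinant 0;
  expansion along that column is the asserted sum, up to the sign \<open>(-1) ^ k\<close>.\<close>

lemma linear_relation_of_maximal_minors:
  fixes a :: "nat \<Rightarrow> nat \<Rightarrow> real"
  assumes "q < k"
  shows "(\<Sum>s<Suc k. (-1) ^ s * a s q * det (mat k k (\<lambda>(i, j). a (insert_index s i) j))) = 0"
proof -
  define f where "f i j = (if j < k then a i j else a i q)" for i j
  have "0 = (-1) ^ k * det (mat (Suc k) (Suc k) (\<lambda>(i, j). f i j))"
    using det_mat_identical_cols[of q k "Suc k" f] assms by (simp add: f_def)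
  also have "\<dots> = (\<Sum>s<Suc k. (-1) ^ k * (f s k * ((-1) ^ (s + k) *
       det (mat k k (\<lambda>(i', j'). f (insert_index s i') (insert_index k j'))))))"
    by (subst det_mat_expand_col[of k]) (auto simp: sum_distrib_left simp del: sum.lessThan_Suc)
  also have "\<dots> = (\<Sum>s<Suc k. (-1) ^ s * a s q * det (mat k k (\<lambda>(i, j). a (insert_index s i) j)))"
  proof (rule sum.cong)
    fix s
    have "(-1::real) ^ k * (-1) ^ (s + k) = (-1) ^ s"
      by (simp add: power_add flip: power_mult_distrib)
    moreover have "det (mat k k (\<lambda>(i', j'). f (insert_index s i') (insert_index k j'))) =
      det (mat k k (\<lambda>(i, j). a (insert_index s i) j))"
      by (rule det_mat_cong) (auto simp: f_def)
    ultimately show "(-1) ^ k * (f s k * ((-1) ^ (s + k) *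
       det (mat k k (\<lambda>(i', j'). f (insert_index s i') (insert_index k j')))))
       = (-1) ^ s * a s q * det (mat k k (\<lambda>(i, j). a (insert_index s i) j))"
      by (simp add: f_def mult.assoc[symmetric] mult.commute[of "(-1) ^ k"])
  qed simp
  finally show ?thesis by simp
qed

text \<open>Substituting the linear relation among the \<open>k + 1\<close> rows into the row at position \<open>m\<close> of a
  \<open>(k - 1) \<times> (k - 1)\<close> determinant kills all terms but three.\<close>

lemma three_term_pluecker:
  fixes a :: "nat \<Rightarrow> nat \<Rightarrow> real"
  assumes m: "m + 2 \<le> Suc k" and q0: "q0 < Suc k"
  defines "M \<equiv> \<lambda>s. det (mat (Suc k) (Suc k) (\<lambda>(i, j). a (insert_index s i) j))"
    and "G \<equiv> \<lambda>s. det (mat k k (\<lambda>(i, j). (if i = m then a s else a (if i < m then i else i + 2)) (insert_index q0 j)))"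
  shows "M (m + 1) * G (m + 1) = M m * G m + M (m + 2) * G (m + 2)"
proof -
  from m obtain k' where k: "k = Suc k'" by (cases k) auto
  \<comment> \<open>The cofactors along row m do not involve the row \<open>a s\<close>, so
    \<open>G\<close> is one fixed linear form evaluated at the rows \<open>a s\<close>, and the
    linear relation with coefficients \<open>(-1) ^ s * M s\<close> can be applied to it.\<close>
  define cof where "cof j = (-1) ^ (m + j) * det (mat k' k' (\<lambda>(i', j').
      a (if insert_index m i' < m then insert_index m i' else insert_index m i' + 2)
        (insert_index q0 (insert_index j j'))))" for j
  have G: "G s = (\<Sum>j<k. a s (insert_index q0 j) * cof j)" for s
  proof -
    have "G s = (\<Sum>j<Suc k'. a s (insert_index q0 j) * ((-1) ^ (m + j) *
       det (mat k' k' (\<lambda>(i', j'). (if insert_index m i' = m then a s else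
          a (if insert_index m i' < m then insert_index m i' else insert_index m i' + 2))
            (insert_index q0 (insert_index j j'))))))"
      unfolding G_def k using m k by (subst det_mat_expand_row[of m]) simp_all
    also have "\<dots> = (\<Sum>j<k. a s (insert_index q0 j) * cof j)"
      unfolding cof_def k
      by (intro sum.cong refl arg_cong2[of _ _ _ _ "(*)"] det_mat_cong) (auto simp: insert_index_def)
    finally show ?thesis .
  qed
  have "(\<Sum>s<Suc (Suc k). (-1) ^ s * M s * G s) =
      (\<Sum>s<Suc (Suc k). \<Sum>j<k. cof j * ((-1) ^ s * a s (insert_index q0 j) * M s))"
    unfolding G sum_distrib_left by (intro sum.cong) (auto simp: mult_ac)
  also have "\<dots> = (\<Sum>j<k. cof j * (\<Sum>s<Suc (Suc k). (-1) ^ s * a s (insert_index q0 j) * M s))"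
    by (subst sum.swap) (simp add: sum_distrib_left del: sum.lessThan_Suc)
  also have "\<dots> = 0"
  proof (rule sum.neutral, rule ballI)
    fix j assume "j \<in> {..<k}"
    then have "insert_index q0 j < Suc k" by (simp add: insert_index_lt)
    from linear_relation_of_maximal_minors[OF this, of a]
    show "cof j * (\<Sum>s<Suc (Suc k). (-1) ^ s * a s (insert_index q0 j) * M s) = 0"
      by (simp add: M_def)
  qed
  finally have "(\<Sum>s<Suc (Suc k). (-1) ^ s * M s * G s) = 0" .
  moreover have "(\<Sum>s<Suc (Suc k). (-1) ^ s * M s * G s) = (\<Sum>s\<in>{m, m + 1, m + 2}. (-1) ^ s * M s * G s)"
  proof (rule sum.mono_neutral_right)
    show "\<forall>s\<in>{..<Suc (Suc k)} - {m, m + 1, m + 2}. (-1) ^ s * M s * G s = 0"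
    proof
      fix s assume s: "s \<in> {..<Suc (Suc k)} - {m, m + 1, m + 2}"
      \<comment> \<open>The row \<open>a s\<close> occurs twice in \<open>G s\<close>: at position
        m, and at position s or s - 2.\<close>
      have "G s = 0"
      proof (cases "s < m")
        case True
        then show ?thesis unfolding G_def
          by (intro det_mat_identical_rows[of s m]) (use m in auto)
      next
        case False
        then show ?thesis unfolding G_def
          by (intro det_mat_identical_rows[of "s - 2" m]) (use m s in \<open>auto simp: numeral_2_eq_2 Suc_diff_Suc\<close>)
      qed
      then show "(-1) ^ s * M s * G s = 0" by simp
    qed
  qed (use m in auto)
  ultimately have "(-1) ^ m * (M m * G m - M (m + 1) * G (m + 1) + M (m + 2) * G (m + 2)) = 0"
    by (simp add: algebra_simps)
  then show ?thesis by simp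
qed

text \<open>Stated for arbitrary integer matrices, since elimination changes single rows and thereby
  leaves the periodic matrices.\<close>

definition tnn :: "(int \<Rightarrow> int \<Rightarrow> real) \<Rightarrow> bool" where
  "tnn x \<longleftrightarrow> (\<forall>k I J. strict_mono_on {..<k} I \<longrightarrow> strict_mono_on {..<k} J \<longrightarrow> 0 \<le> minor x k I J)"

lemma tnnD:
  assumes "tnn x" "strict_mono_on {..<k} I" "strict_mono_on {..<k} J"
  shows "0 \<le> minor x k I J"
  using assms by (auto simp: tnn_def)

lemma strict_mono_on_insert_index:
  assumes "strict_mono_on {..<Suc k} I"
  shows "strict_mono_on {..<k} (I \<circ> insert_index p)"
  using assms by (auto simp: strict_mono_on_def insert_index_def)

lemma minor_cong:
  assumes "\<And>i j. i < k \<Longrightarrow> j < k \<Longrightarrow> x (I i) (J j) = y (I' i) (J' j)"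
  shows "minor x k I J = minor y k I' J'"
  unfolding minor_def by (rule det_mat_cong) (rule assms)

lemma minor_zero_col:
  assumes "q < k" "\<And>p. p < k \<Longrightarrow> x (I p) (J q) = 0"
  shows "minor x k I J = 0"
proof -
  obtain k' where "k = Suc k'" using assms(1) by (cases k) auto
  then show ?thesis
    unfolding minor_def using assms
    by (simp only:) (subst det_mat_expand_col[of q], auto intro!: sum.neutral simp del: sum.lessThan_Suc)
qed

text \<open>\<open>I\<close> is injective, so row p occurs only at position m and linearity in that
  row applies. \<open>I(m := p + 1)\<close> may contain p + 1 twice; then the second minor is
  0.\<close>

lemma minor_subtract_row:
  assumes m: "m < k" and I: "strict_mono_on {..<k} I" and p: "I m = p"
  shows "minor (x(p := \<lambda>j. x p j - c * x (p + 1) j)) k I J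
    = minor x k I J - c * minor x k (I(m := p + 1)) J"
proof -
  let ?x' = "x(p := \<lambda>j. x p j - c * x (p + 1) j)"
  obtain k' where k: "k = Suc k'" using m by (cases k) auto
  have neq: "I i \<noteq> p" if "i \<noteq> m" "i < k" for i
    using strict_mono_on_imp_inj_on[OF I] that m p unfolding inj_on_def by blast
  define D where "D j = (-1) ^ (m + j) * det (mat k' k' (\<lambda>(i', j').
       x (I (insert_index m i')) (J (insert_index j j'))))" for j
  have E: "minor y k I' J = (\<Sum>j<k. y (I' m) (J j) * D j)"
    if "\<And>i j. i < k \<Longrightarrow> i \<noteq> m \<Longrightarrow> y (I' i) j = x (I i) j" for y I'
  proof -
    have ne: "insert_index m i \<noteq> m" for i by (simp add: insert_index_def)
    show ?thesis
      unfolding minor_def k D_def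
      by (subst det_mat_expand_row[of m])
        (use m k ne that in \<open>auto intro!: sum.cong det_mat_cong simp: insert_index_lt simp del: sum.lessThan_Suc\<close>)
  qed
  have "minor ?x' k I J = (\<Sum>j<k. ?x' (I m) (J j) * D j)"
    by (rule E) (use neq in auto)
  moreover have "minor x k I J = (\<Sum>j<k. x (I m) (J j) * D j)"
    by (rule E) auto
  moreover have "minor x k (I(m := p + 1)) J = (\<Sum>j<k. x (p + 1) (J j) * D j)"
    by (subst E) auto
  ultimately show ?thesis
    by (simp add: p sum_distrib_left sum_subtractf algebra_simps)
qed

text \<open>Composition with \<open>insert_index\<close> deletes entries of \<open>R\<close>: in
  each product the large minor omits one of the rows at positions m, m + 1, m + 2 of
  \<open>R\<close>, and the small one omits the other two together with column q.\<close>

lemma minor_pluecker: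
  assumes "m + 2 \<le> Suc k" "q < Suc k"
  shows "minor x (Suc k) (R \<circ> insert_index (m + 1)) J * minor x k (R \<circ> insert_index m \<circ> insert_index (m + 1)) (J \<circ> insert_index q)
    = minor x (Suc k) (R \<circ> insert_index m) J * minor x k (R \<circ> insert_index (m + 1) \<circ> insert_index (m + 1)) (J \<circ> insert_index q)
    + minor x (Suc k) (R \<circ> insert_index (m + 2)) J * minor x k (R \<circ> insert_index m \<circ> insert_index m) (J \<circ> insert_index q)"
proof -
  let ?a = "\<lambda>i j. x (R i) (J j)"
  have eq: "minor x k (R \<circ> f) (J \<circ> insert_index q) = det (mat k k (\<lambda>(i, j). (if i = m then ?a s else ?a (if i < m then i else i + 2)) (insert_index q j)))"
    if "\<And>i. f i = (if i = m then s else if i < m then i else i + 2)" for f s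
    unfolding minor_def by (rule det_mat_cong) (use that in auto)
  have "minor x k (R \<circ> (insert_index m \<circ> insert_index (m + 1))) (J \<circ> insert_index q) = det (mat k k (\<lambda>(i, j). (if i = m then ?a (m + 1) else ?a (if i < m then i else i + 2)) (insert_index q j)))"
    by (rule eq) (auto simp: insert_index_def)
  moreover have "minor x k (R \<circ> (insert_index (m + 1) \<circ> insert_index (m + 1))) (J \<circ> insert_index q) = det (mat k k (\<lambda>(i, j). (if i = m then ?a m else ?a (if i < m then i else i + 2)) (insert_index q j)))"
    by (rule eq) (auto simp: insert_index_def)
  moreover have "minor x k (R \<circ> (insert_index m \<circ> insert_index m)) (J \<circ> insert_index q) = det (mat k k (\<lambda>(i, j). (if i = m then ?a (m + 2) else ?a (if i < m then i else i + 2)) (insert_index q j)))"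
    by (rule eq) (auto simp: insert_index_def)
  ultimately show ?thesis
    using three_term_pluecker[OF assms, of ?a] by (simp add: minor_def comp_def)
qed

text \<open>Whitney's reduction. If \<open>p\<close> is the last row of the minor, it is a minor of \<open>x\<close> with the row
  \<open>p + 1\<close> and the column \<open>l\<close> added; otherwise the Pluecker relation allows dropping the row
  following \<open>p\<close>.\<close>

lemma tnn_subtract_row:
  assumes x: "tnn x" and pos: "x (p + 1) l > 0"
    and above: "\<And>r j. r < p \<Longrightarrow> l \<le> j \<Longrightarrow> x r j = 0"
    and right: "\<And>j. l < j \<Longrightarrow> x p j = 0" "\<And>j. l < j \<Longrightarrow> x (p + 1) j = 0"
  defines "c \<equiv> x p l / x (p + 1) l"
  shows "tnn (x(p := \<lambda>j. x p j - c * x (p + 1) j))"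
proof -
  let ?x' = "x(p := \<lambda>j. x p j - c * x (p + 1) j)"
  \<comment> \<open>The number \<open>d\<close> counts the rows of the minor that come after row
    p.\<close>
  have "0 \<le> minor ?x' k I J"
    if I: "strict_mono_on {..<k} I" and J: "strict_mono_on {..<k} J"
      and m: "m < k" "I m = p" and "d = k - Suc m" for k I J m d
    using that
  proof (induction d arbitrary: k I J)
    case 0
    then have k: "k = Suc m" by simp
    have Ilt: "I i < p" if "i < m" for i
      using strict_mono_onD[OF \<open>strict_mono_on {..<k} I\<close>, of i m] that 0 k by simp
    show ?case
    proof (cases "l \<le> J m")
      case True
      \<comment> \<open>The last column of the minor vanishes: earlier rows are 0 there by
        \<open>above\<close>, and row p is 0 there because c was chosen to clear column l.\<close>
      have "?x' (I i) (J m) = 0" if "i < k" for i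
      proof (cases "i = m")
        case True
        show ?thesis using \<open>I m = p\<close> right[of "J m"] \<open>l \<le> J m\<close> pos True
          by (cases "J m = l") (auto simp: c_def)
      next
        case False
        with Ilt[of i] above[of "I i" "J m"] that k \<open>l \<le> J m\<close> show ?thesis by auto
      qed
      then show ?thesis using minor_zero_col[of m k ?x' I J] k by (simp only: lessI order_refl)
    next
      case False
      \<comment> \<open>Rows before p vanish in the added column l, so expansion along it leaves two
        terms, which combine to \<open>x (p + 1) l\<close> times the reduced minor.\<close>
      let ?I = "I(Suc m := p + 1)" and ?J = "J(Suc m := l)"
      have "strict_mono_on {..<Suc (Suc m)} ?I"
        using 0 k Ilt by (auto simp: strict_mono_on_def less_Suc_eq intro!: less_imp_le)
      moreover have "strict_mono_on {..<Suc (Suc m)} ?J"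
      proof -
        have "J i \<le> J m" if "i \<le> m" for i
          using strict_mono_onD[OF \<open>strict_mono_on {..<k} J\<close>, of i m] that k by (cases "i = m") auto
        then show ?thesis using 0 k False by (fastforce simp: strict_mono_on_def less_Suc_eq)
      qed
      ultimately have "0 \<le> minor x (Suc k) ?I ?J" using x k by (auto intro: tnnD)
      also have "minor x (Suc k) ?I ?J = (\<Sum>i\<in>{m, Suc m}. x (?I i) (?J k) * ((-1) ^ (i + k) *
           minor x k (?I \<circ> insert_index i) (?J \<circ> insert_index k)))"
        unfolding minor_def
        by (subst det_mat_expand_col[of k], simp, rule sum.mono_neutral_cong_right)
          (use k Ilt above in \<open>auto simp: comp_def\<close>)
      also have "\<dots> = x (p + 1) l * minor x k I J - x p l * minor x k (I(m := p + 1)) J"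
      proof -
        have "minor x k (?I \<circ> insert_index (Suc m)) (?J \<circ> insert_index k) = minor x k I J"
          by (rule minor_cong) (use k in auto)
        moreover have "minor x k (?I \<circ> insert_index m) (?J \<circ> insert_index k) = minor x k (I(m := p + 1)) J"
          by (rule minor_cong) (use k in \<open>auto simp: insert_index_def\<close>)
        ultimately show ?thesis using k 0 by simp
      qed
      also have "\<dots> = x (p + 1) l * minor ?x' k I J"
        using minor_subtract_row[OF _ \<open>strict_mono_on {..<k} I\<close> \<open>I m = p\<close>, of x c J] k pos
        by (simp add: c_def field_simps)
      finally have "0 \<le> x (p + 1) l * minor ?x' k I J" .
      then show ?thesis using mult_pos_neg[OF pos, of "minor ?x' k I J"] by linarith
    qed
  next
    case (Suc d)
    then obtain k' where k: "k = Suc k'" by (cases k) auto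
    have mk: "m + 2 \<le> Suc k'" "m < k'" using Suc.prems k by auto
    let ?I' = "I(m := p + 1)"
    have sub: "minor ?x' k I J = minor x k I J - c * minor x k ?I' J"
      using minor_subtract_row[OF \<open>m < k\<close> \<open>strict_mono_on {..<k} I\<close> \<open>I m = p\<close>] .
    have A0: "0 \<le> minor x k I J" using Suc.prems x by (auto intro: tnnD)
    have next_gt: "p < I (m + 1)"
      using strict_mono_onD[OF \<open>strict_mono_on {..<k} I\<close>, of m "m + 1"] mk k \<open>I m = p\<close> by simp
    show ?case
    proof (cases "minor x k ?I' J = 0")
      case True
      then show ?thesis using sub A0 by (simp only: mult_zero_right diff_0_right)
    next
      case False
      have "I (m + 1) \<noteq> p + 1"
        using det_mat_identical_rows[of m "m + 1" k "\<lambda>i j. x (?I' i) (J j)"] False mk k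
        unfolding minor_def by auto
      then have next_gt: "p + 1 < I (m + 1)" using next_gt by simp
      have Ilt: "I i < p" if "i < m" for i
        using strict_mono_onD[OF \<open>strict_mono_on {..<k} I\<close>, of i m] that Suc.prems by simp
      have Igt: "p + 1 < I i" if "m < i" "i < k" for i
        using strict_mono_onD[OF \<open>strict_mono_on {..<k} I\<close>, of "m + 1" i] next_gt that
        by (cases "i = m + 1") auto
      have I': "strict_mono_on {..<k} ?I'"
      proof (rule strict_mono_onI)
        fix i j assume "i \<in> {..<k}" "j \<in> {..<k}" "i < j"
        then show "?I' i < ?I' j"
          using Ilt[of i] Igt[of j] strict_mono_onD[OF \<open>strict_mono_on {..<k} I\<close>, of i j] by auto
      qed
      have B: "0 < minor x k ?I' J" using tnnD[OF x I' \<open>strict_mono_on {..<k} J\<close>] False by simp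
      \<comment> \<open>A nonzero determinant has a nonzero cofactor along row m + 1. Deleting the
        corresponding column q makes this smaller minor positive, so that the final inequality can
        be divided by it.\<close>
      have "\<exists>q<k. minor x k' (?I' \<circ> insert_index (m + 1)) (J \<circ> insert_index q) \<noteq> 0"
      proof (rule ccontr)
        assume "\<not> ?thesis"
        then have "minor x k ?I' J = 0"
          unfolding minor_def k using mk
          by (subst det_mat_expand_row[of "m + 1"]) (auto intro!: sum.neutral simp del: sum.lessThan_Suc)
        with False show False by simp
      qed
      then obtain q where q: "q < k" "minor x k' (?I' \<circ> insert_index (m + 1)) (J \<circ> insert_index q) \<noteq> 0"
        by blast
      let ?C = "J \<circ> insert_index q" and ?L = "I \<circ> insert_index (m + 1)" and ?L' = "?I' \<circ> insert_index (m + 1)"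
      have C: "strict_mono_on {..<k'} ?C" and L: "strict_mono_on {..<k'} ?L" and L': "strict_mono_on {..<k'} ?L'"
        using Suc.prems(1,2) I' unfolding k by - (intro strict_mono_on_insert_index; assumption)+
      have g1: "0 < minor x k' ?L' ?C" using tnnD[OF x L' C] q by simp
      have Lm: "?L m = p" using Suc.prems by simp
      have L'_eq: "?L' = ?L(m := p + 1)" by (auto simp: insert_index_def fun_eq_iff)
      have "0 \<le> minor ?x' k' ?L ?C"
        by (rule Suc.IH[OF L C mk(2) Lm]) (use Suc.prems k in simp)
      then have IH: "c * minor x k' ?L' ?C \<le> minor x k' ?L ?C"
        using minor_subtract_row[OF mk(2) L Lm, of x c ?C] unfolding L'_eq by linarith
      \<comment> \<open>\<open>R\<close> is \<open>I\<close> with p + 1 inserted after p; omitting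
        position m gives \<open>?I'\<close> and omitting position m + 1 gives
        \<open>I\<close>.\<close>
      define R where "R i = (if i \<le> m then I i else if i = m + 1 then p + 1 else I (i - 1))" for i
      have R: "strict_mono_on {..<Suc k} R"
      proof (rule strict_mono_onI)
        fix i j assume ij: "i \<in> {..<Suc k}" "j \<in> {..<Suc k}" "i < j"
        have mono: "I i < I j" if "i < j" "j < k" for i j
          using strict_mono_onD[OF \<open>strict_mono_on {..<k} I\<close>] that by simp
        consider "j \<le> m" | "j = m + 1" | "m + 1 < j" by linarith
        then show "R i < R j"
        proof cases
          case 1 then show ?thesis using ij mono Suc.prems by (simp add: R_def)
        next
          case 2 then show ?thesis using ij Ilt[of i] Suc.prems by (cases "i = m") (auto simp: R_def)
        next
          case 3
          then show ?thesis using ij Igt[of "j - 1"] mono[of i "j - 1"] mono[of "i - 1" "j - 1"]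
            by (auto simp: R_def)
        qed
      qed
      have R1: "R \<circ> insert_index (m + 1) = I" and R0: "R \<circ> insert_index m = ?I'"
        using Suc.prems by (auto simp: R_def insert_index_def fun_eq_iff)
      have "minor x k I J * minor x k' ?L' ?C = minor x k ?I' J * minor x k' ?L ?C
         + minor x k (R \<circ> insert_index (m + 2)) J * minor x k' (?I' \<circ> insert_index m) ?C"
        using minor_pluecker[OF mk(1) q(1)[unfolded k], of x R J] unfolding R0 R1 k .
      moreover have "0 \<le> minor x k (R \<circ> insert_index (m + 2)) J"
        by (rule tnnD[OF x strict_mono_on_insert_index[OF R] \<open>strict_mono_on {..<k} J\<close>])
      moreover have "0 \<le> minor x k' (?I' \<circ> insert_index m) ?C"
        using tnnD[OF x strict_mono_on_insert_index C] I' k by blast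
      ultimately have "minor x k ?I' J * minor x k' ?L ?C \<le> minor x k I J * minor x k' ?L' ?C"
        by simp
      moreover have "minor x k ?I' J * (c * minor x k' ?L' ?C) \<le> minor x k ?I' J * minor x k' ?L ?C"
        using IH B by (intro mult_left_mono) auto
      ultimately have "(c * minor x k ?I' J) * minor x k' ?L' ?C \<le> minor x k I J * minor x k' ?L' ?C"
        by (simp add: mult_ac)
      then have "c * minor x k ?I' J \<le> minor x k I J" using g1 by simp
      then show ?thesis using sub by linarith
    qed
  qed
  note main = this
  show ?thesis
    unfolding tnn_def
  proof (intro allI impI)
    fix k and I J :: "nat \<Rightarrow> int" assume I: "strict_mono_on {..<k} I" and J: "strict_mono_on {..<k} J"
    show "0 \<le> minor ?x' k I J"
    proof (cases "\<exists>m<k. I m = p")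
      case True
      then show ?thesis using main[OF I J] by blast
    next
      case False
      then have "minor ?x' k I J = minor x k I J" by (intro minor_cong) auto
      then show ?thesis using tnnD[OF x I J] by simp
    qed
  qed
qed

text \<open>The reductions do not interfere: by \<open>sep\<close> the row p + 1 subtracted from row
  p lies outside P and is therefore still the original one.\<close>

lemma tnn_subtract_rows:
  assumes x: "tnn x" and "finite P"
    and P: "\<And>p. p \<in> P \<Longrightarrow> x (p + 1) (l p) > 0"
      "\<And>p. p \<in> P \<Longrightarrow> c = x p (l p) / x (p + 1) (l p)"
      "\<And>p r j. p \<in> P \<Longrightarrow> r < p \<Longrightarrow> l p \<le> j \<Longrightarrow> x r j = 0"
      "\<And>p j. p \<in> P \<Longrightarrow> l p < j \<Longrightarrow> x p j = 0 \<and> x (p + 1) j = 0"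
    and sep: "\<And>p p'. p \<in> P \<Longrightarrow> p' \<in> P \<Longrightarrow> p < p' \<Longrightarrow> p + 1 < p'"
  shows "tnn (\<lambda>r j. x r j - (if r \<in> P then c * x (r + 1) j else 0))"
  using \<open>finite P\<close> P sep
proof (induction P rule: finite_induct)
  case empty
  then show ?case using x by simp
next
  case (insert p P)
  let ?y = "\<lambda>r j. x r j - (if r \<in> P then c * x (r + 1) j else 0)"
  have tnn_y: "tnn ?y"
  proof (rule insert.IH)
    show "x r j = 0" if "p' \<in> P" "r < p'" "l p' \<le> j" for p' r j
      by (rule insert.prems(3)) (use that in auto)
    show "r + 1 < r'" if "r \<in> P" "r' \<in> P" "r < r'" for r r'
      by (rule insert.prems(5)) (use that in auto)
    show "x p' j = 0 \<and> x (p' + 1) j = 0" if "p' \<in> P" "l p' < j" for p' j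
      by (rule insert.prems(4)) (use that in auto)
    show "0 < x (p' + 1) (l p')" "c = x p' (l p') / x (p' + 1) (l p')" if "p' \<in> P" for p'
      using insert.prems(1,2)[of p'] that by auto
  qed
  have "p + 1 \<notin> P" using insert.prems(5)[of p "p + 1"] by auto
  \<comment> \<open>If r < p lies in P, then r + 1 < p by separation, so the row subtracted from row
    r also vanishes from column \<open>l p\<close> on.\<close>
  have above: "?y r j = 0" if "r < p" "l p \<le> j" for r j
    using that insert.prems(3)[of p r j] insert.prems(3)[of p "r + 1" j] insert.prems(5)[of r p] by auto
  have "tnn (?y(p := \<lambda>j. ?y p j - ?y p (l p) / ?y (p + 1) (l p) * ?y (p + 1) j))"
    by (rule tnn_subtract_row[OF tnn_y])
      (use insert.prems(1,4)[of p] above insert.hyps \<open>p + 1 \<notin> P\<close> in simp_all)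
  also have "?y(p := \<lambda>j. ?y p j - ?y p (l p) / ?y (p + 1) (l p) * ?y (p + 1) j)
      = (\<lambda>r j. x r j - (if r \<in> insert p P then c * x (r + 1) j else 0))"
  proof (intro ext)
    fix r j
    have "c = x p (l p) / x (p + 1) (l p)" using insert.prems(2)[of p] by blast
    then show "(?y(p := \<lambda>j. ?y p j - ?y p (l p) / ?y (p + 1) (l p) * ?y (p + 1) j)) r j
      = x r j - (if r \<in> insert p P then c * x (r + 1) j else 0)"
      using insert.hyps \<open>p + 1 \<notin> P\<close> by (cases "r = p") simp_all
  qed
  finally show ?case .
qed

section \<open>Periodic matrices\<close>

definition periodic :: "nat \<Rightarrow> (int \<Rightarrow> int \<Rightarrow> real) \<Rightarrow> bool" where
  "periodic n x \<longleftrightarrow> (\<forall>i j. x (i + int n) (j + int n) = x i j)"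

lemma periodic_shift:
  assumes "periodic n x"
  shows "x (i + t * int n) (j + t * int n) = x i j"
proof (induction t rule: int_induct[where k = 0])
  case (step1 t)
  then show ?case using assms[unfolded periodic_def, rule_format, of "i + t * int n" "j + t * int n"]
    by (simp add: algebra_simps)
next
  case (step2 t)
  then show ?case using assms[unfolded periodic_def, rule_format, of "i + (t - 1) * int n" "j + (t - 1) * int n"]
    by (simp add: algebra_simps)
qed simp

lemma periodic_mod_eq:
  assumes "periodic n x" "i' mod int n = i mod int n"
  shows "x i' j = x i (j + i - i')"
proof -
  have "int n dvd i' - i" using assms(2) by (simp add: mod_eq_dvd_iff)
  then obtain t where "i' - i = int n * t" by (elim dvdE)
  then have i': "i + t * int n = i'" by (simp add: algebra_simps)
  then have j: "j + i - i' + t * int n = j" by linarith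
  show ?thesis using periodic_shift[OF assms(1), of i t "j + i - i'"] unfolding i' j .
qed

text \<open>A minor meets only finitely many rows of the residue class of p, so it is also a minor
  of a matrix with finitely many rows reduced. As n is at least 2, the class contains no two
  adjacent rows.\<close>

lemma tnn_subtract_periodic:
  assumes n: "n \<ge> 2" and x: "tnn x" "periodic n x" and pos: "x (p + 1) l > 0"
    and above: "\<And>(r::int) (j::int). r < p \<Longrightarrow> l \<le> j \<Longrightarrow> x r j = 0"
    and right: "\<And>j. l < j \<Longrightarrow> x p j = 0" "\<And>j. l < j \<Longrightarrow> x (p + 1) j = 0"
  defines "c \<equiv> x p l / x (p + 1) l"
  shows "tnn (\<lambda>(r::int) (j::int). x r j - (if r mod int n = p mod int n then c * x (r + 1) j else 0))"
    (is "tnn ?y")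
  unfolding tnn_def
proof (intro allI impI)
  fix k and I J :: "nat \<Rightarrow> int" assume I: "strict_mono_on {..<k} I" and J: "strict_mono_on {..<k} J"
  define P where "P = {r \<in> I ` {..<k}. r mod int n = p mod int n}"
  have row: "x r j = x p (j + p - r)" "x (r + 1) j = x (p + 1) (j + p - r)" if "r \<in> P" for r j
  proof -
    have r: "r mod int n = p mod int n" using that by (simp add: P_def)
    show "x r j = x p (j + p - r)" by (rule periodic_mod_eq[OF x(2) r])
    have "(r + 1) mod int n = (p + 1) mod int n" by (rule mod_add_cong[OF r refl])
    moreover have "j + (p + 1) - (r + 1) = j + p - r" by simp
    ultimately show "x (r + 1) j = x (p + 1) (j + p - r)"
      using periodic_mod_eq[OF x(2), of "r + 1" "p + 1" j] by (simp only:)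
  qed
  have "tnn (\<lambda>r j. x r j - (if r \<in> P then c * x (r + 1) j else 0))"
  proof (rule tnn_subtract_rows[OF x(1), where l = "\<lambda>r. l + r - p"])
    show "x r j = 0" if "r' \<in> P" "r < r'" "l + r' - p \<le> j" for r' r j
    proof -
      have "int n dvd r' - p" using \<open>r' \<in> P\<close> by (simp add: P_def mod_eq_dvd_iff)
      then obtain t where "r' - p = int n * t" by (elim dvdE)
      then have "r' = p + t * int n" by (simp add: algebra_simps)
      then show ?thesis
        using above[of "r - t * int n" "j - t * int n"] that(2,3)
          periodic_shift[OF x(2), of "r - t * int n" t "j - t * int n"] by simp
    qed
    show "r + 1 < r'" if "r \<in> P" "r' \<in> P" "r < r'" for r r'
    proof (rule ccontr)
      assume "\<not> r + 1 < r'"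
      then have "r' = r + 1" using that by simp
      then have "(r + 1) mod int n = r mod int n" using that by (simp add: P_def)
      then have "int n dvd 1" by (metis add_diff_cancel_left' mod_eq_dvd_iff)
      then show False using n by simp
    qed
    show "0 < x (r + 1) (l + r - p)" if "r \<in> P" for r
      using row(2)[OF that, of "l + r - p"] pos by simp
    show "c = x r (l + r - p) / x (r + 1) (l + r - p)" if "r \<in> P" for r
      using row[OF that, of "l + r - p"] by (simp add: c_def)
    show "x r j = 0 \<and> x (r + 1) j = 0" if "r \<in> P" "l + r - p < j" for r j
      using row[OF that(1), of j] right[of "j + p - r"] that(2) by simp
  qed (simp add: P_def)
  from tnnD[OF this I J] show "0 \<le> minor ?y k I J"
    by (subst minor_cong[of k ?y I J]) (auto simp: P_def)
qed

section \<open>Unfoldings of products\<close>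

lemma periodic_unfolding: "n > 0 \<Longrightarrow> periodic n (unfolding_of n A)"
proof -
  assume n: "n > 0"
  have "(i + int n - 1) mod int n = (i - 1) mod int n" for i
    by (metis add_diff_eq diff_add_eq mod_add_self2)
  moreover have "(i + int n - 1) div int n = (i - 1) div int n + 1" for i
    using div_add_self2[of "int n" "i - 1"] n by (simp add: algebra_simps)
  ultimately show ?thesis by (simp add: periodic_def unfolding_of_def)
qed

lemma unfolding_inject:
  assumes "A \<in> carrier_mat n n" "B \<in> carrier_mat n n" "unfolding_of n A = unfolding_of n B"
  shows "A = B"
proof (rule eq_matI)
  fix p q assume "p < dim_row B" "q < dim_col B"
  then have pq: "p < n" "q < n" using assms by auto
  show "A $$ (p, q) = B $$ (p, q)"
  proof (rule fls_eqI)
    fix k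
    have "unfolding_of n A (int p + 1) (int q + 1 + k * int n) = unfolding_of n B (int p + 1) (int q + 1 + k * int n)"
      using assms(3) by simp
    then show "fls_nth (A $$ (p, q)) k = fls_nth (B $$ (p, q)) k"
      using pq by (simp add: unfolding_of_def)
  qed
qed (use assms in auto)

lemma unfolding_folding:
  assumes n: "n > 0" and x: "periodic n x" "\<And>i j. j < i \<Longrightarrow> x i j = 0"
  shows "unfolding_of n (folding_of n x) = x"
proof (intro ext)
  fix i j
  let ?p = "(i - 1) mod int n" and ?q = "(j - 1) mod int n"
  have pq: "0 \<le> ?p" "?p < int n" "0 \<le> ?q" "?q < int n" using n by auto
  have "fls_nth (Abs_fls (\<lambda>k. x (?p + 1) (?q + 1 + k * int n))) ((j - 1) div int n - (i - 1) div int n)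
    = x (?p + 1) (?q + 1 + ((j - 1) div int n - (i - 1) div int n) * int n)"
  proof (rule nth_Abs_fls_ex_lower_bound, intro exI allI impI)
    fix k :: int assume "k < - 1"
    then have "k * int n \<le> -2 * int n" using n by (intro mult_right_mono) auto
    then show "x (?p + 1) (?q + 1 + k * int n) = 0" using pq by (intro x) linarith
  qed
  also have "\<dots> = x (?p + 1 + (i - 1) div int n * int n)
      (?q + 1 + ((j - 1) div int n - (i - 1) div int n) * int n + (i - 1) div int n * int n)"
    by (rule periodic_shift[OF x(1), symmetric])
  also have "?p + 1 + (i - 1) div int n * int n = i" using div_mult_mod_eq[of "i - 1" "int n"] by linarith
  also have "?q + 1 + ((j - 1) div int n - (i - 1) div int n) * int n + (i - 1) div int n * int n = j"
    using div_mult_mod_eq[of "j - 1" "int n"] by (simp add: algebra_simps)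
  finally show "unfolding_of n (folding_of n x) i j = x i j"
    using pq by (simp add: unfolding_of_def folding_of_def nat_less_iff)
qed

text \<open>The unipotent condition of \<open>loop_U\<close> by itself, so that membership can be
  checked on unfoldings.\<close>

definition unitri :: "nat \<Rightarrow> real fls mat set" where
  "unitri n = {A \<in> carrier_mat n n. (\<forall>i. unfolding_of n A i i = 1) \<and> (\<forall>i j. j < i \<longrightarrow> unfolding_of n A i j = 0)}"

text \<open>The convolution is usually summed between bounds given by subdegrees; here the bounds
  are independent of the factors, so that sums for different matrix entries can be merged.\<close>

lemma fls_times_nth_nonneg:
  fixes f g :: "real fls"
  assumes "\<And>k. k < 0 \<Longrightarrow> fls_nth f k = 0" "\<And>k. k < 0 \<Longrightarrow> fls_nth g k = 0"
  shows "fls_nth (f * g) m = (\<Sum>k\<in>{0..m}. fls_nth f k * fls_nth g (m - k))"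
proof -
  have "fls_nth (f * g) m = (\<Sum>i=fls_subdegree f..m - fls_subdegree g. fls_nth f i * fls_nth g (m - i))"
    by (rule fls_times_nth(2))
  also have "\<dots> = (\<Sum>k\<in>{0..m}. fls_nth f k * fls_nth g (m - k))"
  proof (cases "f = 0 \<or> g = 0")
    case True
    then show ?thesis by auto
  next
    case False
    then have "fls_subdegree f \<ge> 0" "fls_subdegree g \<ge> 0"
      using assms by (metis nth_fls_subdegree_nonzero not_le)+
    then show ?thesis
      by (intro sum.mono_neutral_left) (auto simp: not_le)
  qed
  finally show ?thesis .
qed

text \<open>An intermediate index k is uniquely q + 1 + s n with 0 <= q < n, so the sum over q from
  the matrix product and the sum over s from the convolution become one sum over k. Triangularity
  restricts it to the interval from i to j.\<close>

lemma unfolding_mult: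
  assumes n: "n > 0" and A: "A \<in> unitri n" and B: "B \<in> unitri n"
  shows "unfolding_of n (A * B) i j = (\<Sum>k\<in>{i..j}. unfolding_of n A i k * unfolding_of n B k j)"
proof -
  define p di where "p = nat ((i - 1) mod int n)" and "di = (i - 1) div int n"
  define r dj where "r = nat ((j - 1) mod int n)" and "dj = (j - 1) div int n"
  have pr: "p < n" "r < n" using n by (auto simp: p_def r_def nat_less_iff)
  have i: "i = int p + 1 + di * int n" and j: "j = int r + 1 + dj * int n"
    using n div_mult_mod_eq[of "i - 1" "int n"] div_mult_mod_eq[of "j - 1" "int n"]
    by (simp_all add: p_def di_def r_def dj_def)
  have car: "A \<in> carrier_mat n n" "B \<in> carrier_mat n n" using A B by (auto simp: unitri_def)
  have nth: "fls_nth (C $$ (a, b)) k = unfolding_of n C (int a + 1) (int b + 1 + k * int n)"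
    if "a < n" "b < n" for C a b k using that by (simp add: unfolding_of_def)
  have neg: "fls_nth (C $$ (a, b)) k = 0" if "C \<in> unitri n" "a < n" "b < n" "k < 0" for C a b k
  proof -
    have "k * int n \<le> -1 * int n" using that n by (intro mult_right_mono) auto
    then have "int b + 1 + k * int n < int a + 1" using that by linarith
    then show ?thesis using that by (simp add: nth unitri_def)
  qed
  have U: "unfolding_of n C (int a + 1 + d * int n) (int b + 1 + e * int n) = fls_nth (C $$ (a, b)) (e - d)"
    if "a < n" "b < n" for C a b d e using that n by (simp add: unfolding_of_def)
  let ?e = "\<lambda>(q, s). int q + 1 + s * int n"
  have "unfolding_of n (A * B) i j = fls_nth ((A * B) $$ (p, r)) (dj - di)"
    by (simp add: unfolding_of_def p_def di_def r_def dj_def)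
  also have "\<dots> = (\<Sum>q<n. fls_nth (A $$ (p, q) * B $$ (q, r)) (dj - di))"
    using car pr by (simp add: scalar_prod_def fls_nth_sum atLeast0LessThan)
  also have "\<dots> = (\<Sum>q<n. \<Sum>s\<in>{0..dj - di}. fls_nth (A $$ (p, q)) s * fls_nth (B $$ (q, r)) (dj - di - s))"
    using pr neg A B by (intro sum.cong refl fls_times_nth_nonneg) auto
  also have "\<dots> = (\<Sum>q<n. \<Sum>s\<in>{di..dj}. fls_nth (A $$ (p, q)) (s - di) * fls_nth (B $$ (q, r)) (dj - s))"
    by (intro sum.cong refl sum.reindex_bij_witness[where i = "\<lambda>s. s - di" and j = "\<lambda>s. s + di"]) (auto simp: algebra_simps)
  also have "\<dots> = (\<Sum>(q, s)\<in>{..<n} \<times> {di..dj}. unfolding_of n A i (?e (q, s)) * unfolding_of n B (?e (q, s)) j)"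
    unfolding sum.cartesian_product i j by (intro sum.cong refl) (use pr in \<open>auto simp: U\<close>)
  also have "\<dots> = (\<Sum>k\<in>?e ` ({..<n} \<times> {di..dj}). unfolding_of n A i k * unfolding_of n B k j)"
  proof -
    have "inj_on ?e ({..<n} \<times> {di..dj})"
    proof (rule inj_onI, clarsimp)
      fix q q' s s' assume *: "q < n" "q' < n" "int q + s * int n = int q' + s' * int n"
      have "(int q + s * int n) div int n = s" if "q < n" for q s using that by simp
      then have "s = s'" using * by metis
      then show "q = q' \<and> s = s'" using * by simp
    qed
    then show ?thesis by (simp add: sum.reindex case_prod_unfold)
  qed
  also have "\<dots> = (\<Sum>k\<in>{i..j}. unfolding_of n A i k * unfolding_of n B k j)"
  proof (rule sum.mono_neutral_right)
    show "{i..j} \<subseteq> ?e ` ({..<n} \<times> {di..dj})"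
    proof
      fix k assume k: "k \<in> {i..j}"
      have "k = int (nat ((k - 1) mod int n)) + 1 + (k - 1) div int n * int n"
        using n div_mult_mod_eq[of "k - 1" "int n"] by simp
      moreover have "di \<le> (k - 1) div int n" "(k - 1) div int n \<le> dj"
        unfolding di_def dj_def using k n by (auto intro!: zdiv_mono1)
      ultimately show "k \<in> ?e ` ({..<n} \<times> {di..dj})"
        using n by (intro image_eqI[where x = "(nat ((k - 1) mod int n), (k - 1) div int n)"])
          (auto simp: nat_less_iff)
    qed
    show "\<forall>k\<in>?e ` ({..<n} \<times> {di..dj}) - {i..j}. unfolding_of n A i k * unfolding_of n B k j = 0"
    proof
      fix k assume "k \<in> ?e ` ({..<n} \<times> {di..dj}) - {i..j}"
      then have "k < i \<or> j < k" by auto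
      then show "unfolding_of n A i k * unfolding_of n B k j = 0"
        using A B unfolding unitri_def by auto
    qed
  qed auto
  finally show ?thesis .
qed

lemma unitri_mult:
  assumes "n > 0" "A \<in> unitri n" "B \<in> unitri n"
  shows "A * B \<in> unitri n"
  using assms unfolding unitri_def by (auto simp: unfolding_mult[unfolded unitri_def])

lemma unfolding_one: "n > 0 \<Longrightarrow> unfolding_of n (1\<^sub>m n) i j = (if i = j then 1 else 0)"
proof -
  assume n: "n > 0"
  have "(i - 1) mod int n = (j - 1) mod int n \<Longrightarrow> (i - 1) div int n = (j - 1) div int n \<Longrightarrow> i = j"
    by (metis add_right_imp_eq diff_add_cancel div_mult_mod_eq)
  then show ?thesis using n
    by (auto simp: unfolding_of_def nat_less_iff eq_nat_nat_iff)
qed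

lemma unitri_one: "n > 0 \<Longrightarrow> 1\<^sub>m n \<in> unitri n"
  by (auto simp: unitri_def unfolding_one)

lemma unfolding_chevalley:
  assumes "n \<ge> 2"
  shows "unfolding_of n (chevalley n i a) =
    (\<lambda>p q. if p = q then 1 else if p mod int n = i mod int n \<and> q = p + 1 then a else 0)"
  unfolding chevalley_def
  by (rule unfolding_folding) (use assms in \<open>auto simp: periodic_def\<close>)

lemma chevalley_carrier: "chevalley n i a \<in> carrier_mat n n"
  by (simp add: chevalley_def folding_of_def)

lemma unitri_chevalley: "n \<ge> 2 \<Longrightarrow> chevalley n i a \<in> unitri n"
  by (auto simp: unitri_def unfolding_chevalley chevalley_carrier)

lemma unfolding_mult_chevalley:
  assumes "n \<ge> 2" "A \<in> unitri n"
  shows "unfolding_of n (A * chevalley n i a) p q = unfolding_of n A p q +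
    (if (q - 1) mod int n = i mod int n then a * unfolding_of n A p (q - 1) else 0)"
proof -
  let ?A = "unfolding_of n A"
  have low: "?A p k = 0" if "k < p" for k using assms that by (simp add: unitri_def)
  have "unfolding_of n (A * chevalley n i a) p q = (\<Sum>k\<in>{p..q}. ?A p k * unfolding_of n (chevalley n i a) k q)"
    using assms by (intro unfolding_mult unitri_chevalley) auto
  also have "\<dots> = (\<Sum>k\<in>{q - 1, q}. ?A p k * unfolding_of n (chevalley n i a) k q)"
    using low assms(1) by (intro sum.mono_neutral_cong) (auto simp: unfolding_chevalley)
  also have "\<dots> = ?A p q + (if (q - 1) mod int n = i mod int n then a * ?A p (q - 1) else 0)"
    using assms(1) by (simp add: unfolding_chevalley)
  finally show ?thesis .
qed

lemma unfolding_chevalley_mult: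
  assumes "n \<ge> 2" "A \<in> unitri n"
  shows "unfolding_of n (chevalley n i a * A) p q = unfolding_of n A p q +
    (if p mod int n = i mod int n then a * unfolding_of n A (p + 1) q else 0)"
proof -
  let ?A = "unfolding_of n A"
  have low: "?A k q = 0" if "q < k" for k using assms that by (simp add: unitri_def)
  have "unfolding_of n (chevalley n i a * A) p q = (\<Sum>k\<in>{p..q}. unfolding_of n (chevalley n i a) p k * ?A k q)"
    using assms by (intro unfolding_mult unitri_chevalley) auto
  also have "\<dots> = (\<Sum>k\<in>{p, p + 1}. unfolding_of n (chevalley n i a) p k * ?A k q)"
    using low assms(1) by (intro sum.mono_neutral_cong) (auto simp: unfolding_chevalley)
  also have "\<dots> = ?A p q + (if p mod int n = i mod int n then a * ?A (p + 1) q else 0)"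
    using assms(1) by (simp add: unfolding_chevalley)
  finally show ?thesis .
qed

lemma chevalley_inverse:
  assumes "n \<ge> 2"
  shows "chevalley n i a * chevalley n i (- a) = 1\<^sub>m n"
proof (rule unfolding_inject)
  \<comment> \<open>Adjacent indices are never congruent, so the off-diagonal part of a generator
    squares to zero.\<close>
  have ne: "j mod int n \<noteq> i mod int n" if "(1 + j) mod int n = i mod int n" for j
  proof
    assume "j mod int n = i mod int n"
    then have "int n dvd 1" using that by (metis add_diff_cancel_right' mod_eq_dvd_iff)
    then show False using assms by simp
  qed
  show "unfolding_of n (chevalley n i a * chevalley n i (- a)) = unfolding_of n (1\<^sub>m n)"
    using assms ne
    by (intro ext) (auto simp: unfolding_mult_chevalley unitri_chevalley unfolding_chevalley unfolding_one)
qed (auto intro: mult_carrier_mat chevalley_carrier)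

section \<open>Factorization of banded totally nonnegative matrices\<close>

lemma chevalley_word_Nil [simp]: "chevalley_word n [] as = 1\<^sub>m n"
  by (simp add: chevalley_word_def)

lemma chevalley_word_Cons [simp]:
  "chevalley_word n (i # is) (a # as) = chevalley n i a * chevalley_word n is as"
  by (simp add: chevalley_word_def)

lemma unitri_carrier: "A \<in> unitri n \<Longrightarrow> A \<in> carrier_mat n n"
  by (simp add: unitri_def)

lemma unitri_chevalley_word:
  assumes "n \<ge> 2" "length is = length as"
  shows "chevalley_word n is as \<in> unitri n"
  using assms(2)
  by (induction "is" as rule: list_induct2)
    (use assms(1) in \<open>auto intro: unitri_one unitri_mult unitri_chevalley\<close>)

lemma chevalley_word_snoc:
  assumes "n \<ge> 2" "length is = length as"
  shows "chevalley_word n (is @ [i]) (as @ [a]) = chevalley_word n is as * chevalley n i a"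
  using assms(2)
proof (induction "is" as rule: list_induct2)
  case Nil
  then show ?case using chevalley_carrier[of n i a] by simp
next
  case (Cons j js b bs)
  then show ?case
    using chevalley_carrier unitri_carrier[OF unitri_chevalley_word[OF assms(1) Cons.hyps]]
    by (simp add: assoc_mult_mat[of _ n n _ n _ n])
qed

definition banded :: "(int \<Rightarrow> int \<Rightarrow> real) \<Rightarrow> bool" where
  "banded x \<longleftrightarrow> (\<exists>b. \<forall>i j. i + b < j \<longrightarrow> x i j = 0)"

lemma banded_mult:
  assumes "n > 0" "A \<in> unitri n" "B \<in> unitri n" "banded (unfolding_of n A)" "banded (unfolding_of n B)"
  shows "banded (unfolding_of n (A * B))"
proof -
  obtain b c where b: "\<And>i j. i + b < j \<Longrightarrow> unfolding_of n A i j = 0"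
    and c: "\<And>i j. i + c < j \<Longrightarrow> unfolding_of n B i j = 0"
    using assms(4,5) unfolding banded_def by blast
  have "unfolding_of n (A * B) i j = 0" if "i + (b + c) < j" for i j
  proof -
    have "unfolding_of n A i k * unfolding_of n B k j = 0" for k
      using b[of i k] c[of k j] that by (cases "i + b < k") auto
    then show ?thesis unfolding unfolding_mult[OF assms(1-3)] by (intro sum.neutral ballI)
  qed
  then show ?thesis unfolding banded_def by blast
qed

lemma banded_chevalley: "n \<ge> 2 \<Longrightarrow> banded (unfolding_of n (chevalley n i a))"
  unfolding banded_def by (rule exI[of _ 1]) (simp add: unfolding_chevalley)

lemma banded_one: "n > 0 \<Longrightarrow> banded (unfolding_of n (1\<^sub>m n))"
  unfolding banded_def by (rule exI[of _ 0]) (simp add: unfolding_one)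

lemma banded_chevalley_word:
  assumes "n \<ge> 2" "length is = length as"
  shows "banded (unfolding_of n (chevalley_word n is as))"
  using assms(2)
  by (induction "is" as rule: list_induct2)
    (use assms(1) in \<open>auto intro: banded_one banded_mult banded_chevalley unitri_chevalley unitri_chevalley_word\<close>)

text \<open>The inverse is the reversed product with negated parameters, and every factor is
  banded.\<close>

lemma chevalley_word_inverse:
  assumes n: "n \<ge> 2" and "length is = length as"
  shows "\<exists>W \<in> unitri n. banded (unfolding_of n W) \<and> chevalley_word n is as * W = 1\<^sub>m n"
  using assms(2)
proof (induction "is" as rule: list_induct2)
  case Nil
  then show ?case using n by (intro bexI[of _ "1\<^sub>m n"]) (auto intro: unitri_one banded_one)
next
  case (Cons i "is" a as)
  then obtain W where W: "W \<in> unitri n" "banded (unfolding_of n W)" "chevalley_word n is as * W = 1\<^sub>m n"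
    by blast
  let ?X = "chevalley_word n is as" and ?e = "chevalley n i a" and ?f = "chevalley n i (- a)"
  have car: "?X \<in> carrier_mat n n" "W \<in> carrier_mat n n" "?e \<in> carrier_mat n n" "?f \<in> carrier_mat n n"
    using unitri_carrier[OF W(1)] unitri_carrier[OF unitri_chevalley_word[OF n Cons.hyps]] chevalley_carrier by auto
  have "(?e * ?X) * (W * ?f) = ?e * (?X * (W * ?f))"
    using car by (intro assoc_mult_mat[of _ n n _ n _ n]) auto
  also have "?X * (W * ?f) = (?X * W) * ?f"
    using car by (intro assoc_mult_mat[symmetric, of _ n n _ n _ n]) auto
  also have "?e * ((?X * W) * ?f) = 1\<^sub>m n" using W car n by (simp add: chevalley_inverse)
  finally show ?case
    using W n by (intro bexI[of _ "W * ?f"]) (auto intro!: unitri_mult banded_mult unitri_chevalley banded_chevalley)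
qed

section \<open>Finding an elimination step and factoring\<close>

lemma tnn_nonneg: "tnn x \<Longrightarrow> 0 \<le> x i j"
proof -
  assume "tnn x"
  moreover have "strict_mono_on {..<1::nat} (\<lambda>_. i)" for i :: int by (auto simp: strict_mono_on_def)
  ultimately have "0 \<le> minor x 1 (\<lambda>_. i) (\<lambda>_. j)" by (intro tnnD)
  then show ?thesis by (simp add: minor_def det_single)
qed

lemma tnn_minor2:
  assumes "tnn x" "i < i'" "j < j'"
  shows "x i j' * x i' j \<le> x i j * x i' j'"
proof -
  have "0 \<le> minor x 2 (\<lambda>k. if k = 0 then i else i') (\<lambda>k. if k = 0 then j else j')"
    by (rule tnnD) (use assms in \<open>auto simp: strict_mono_on_def\<close>)
  then show ?thesis
    unfolding minor_def numeral_2_eq_2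
    by (subst (asm) det_mat_expand_row[of 0]) (simp_all add: det_single insert_index_def)
qed

text \<open>If the last nonzero columns of the rows were strictly increasing, they would form a single
  diagonal, and multiplying by a banded matrix could only push it away from the main diagonal.\<close>

lemma exists_reducible_row:
  assumes n: "n \<ge> 2" and y: "periodic n y" "tnn y" "banded y"
    and diag: "\<And>i. y i i = 1" and low: "\<And>i j. j < i \<Longrightarrow> y i j = 0"
    and v: "banded v" "\<And>i. v i i = 1" "\<And>i j. j < i \<Longrightarrow> v i j = 0"
    and inv: "\<And>i j. (\<Sum>k\<in>{i..j}. v i k * y k j) = (if i = j then 1 else 0)"
    and nontriv: "y a b \<noteq> (if a = b then 1 else 0)"
  obtains p l where "y p l > 0" "y (p + 1) l > 0" "\<And>r j. r < p \<Longrightarrow> l \<le> j \<Longrightarrow> y r j = 0"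
    "\<And>j. l < j \<Longrightarrow> y p j = 0" "\<And>j. l < j \<Longrightarrow> y (p + 1) j = 0"
proof -
  have last: "\<exists>L. \<forall>i. x i (L i) \<noteq> 0 \<and> (\<forall>j. x i j \<noteq> 0 \<longrightarrow> j \<le> L i)"
    if "banded x" "\<And>i. x i i = 1" "\<And>i j. j < i \<Longrightarrow> x i j = 0" for x :: "int \<Rightarrow> int \<Rightarrow> real"
  proof -
    from that(1) obtain b where b: "\<And>i j. i + b < j \<Longrightarrow> x i j = 0" unfolding banded_def by blast
    have "{j. x i j \<noteq> 0} \<subseteq> {i..i + b}" for i using b[of i] that(3)[of _ i] by (auto simp: not_less[symmetric])
    then have "finite {j. x i j \<noteq> 0}" for i by (rule finite_subset) simp
    moreover have "i \<in> {j. x i j \<noteq> 0}" for i using that by simp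
    ultimately have "x i (Max {j. x i j \<noteq> 0}) \<noteq> 0 \<and> (\<forall>j. x i j \<noteq> 0 \<longrightarrow> j \<le> Max {j. x i j \<noteq> 0})" for i
      using Max_in[of "{j. x i j \<noteq> 0}"] by (auto intro!: Max_ge)
    then show ?thesis by (intro exI[of _ "\<lambda>i. Max {j. x i j \<noteq> 0}"]) blast
  qed
  from last[OF y(3) diag low] obtain L where L: "\<And>i. y i (L i) \<noteq> 0" "\<And>i j. y i j \<noteq> 0 \<Longrightarrow> j \<le> L i"
    by blast
  from last[OF v] obtain M where M: "\<And>i. v i (M i) \<noteq> 0" "\<And>i j. v i j \<noteq> 0 \<Longrightarrow> j \<le> M i"
    by blast
  from y(3) obtain w where w: "\<And>i j. i + w < j \<Longrightarrow> y i j = 0" unfolding banded_def by blast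
  have L_ge: "i \<le> L i" for i using L(2)[of i i] diag by simp
  have L_le: "L i \<le> i + w" for i using L(1)[of i] w[of i "L i"] by force
  have pos: "y i j > 0" if "y i j \<noteq> 0" for i j using tnn_nonneg[OF y(2), of i j] that by simp
  \<comment> \<open>Otherwise the 2 by 2 minor with rows i, i + 1 and columns
    \<open>L (i + 1)\<close>, \<open>L i\<close> is negative.\<close>
  have L_step: "L i \<le> L (i + 1)" for i
  proof (rule ccontr)
    assume "\<not> L i \<le> L (i + 1)"
    then have "y i (L i) * y (i + 1) (L (i + 1)) \<le> y i (L (i + 1)) * y (i + 1) (L i)"
      by (intro tnn_minor2[OF y(2)]) auto
    moreover have "y (i + 1) (L i) = 0" using L(2)[of "i + 1" "L i"] \<open>\<not> L i \<le> L (i + 1)\<close> by auto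
    moreover have "0 < y i (L i) * y (i + 1) (L (i + 1))" using L(1) by (simp add: pos)
    ultimately show False by simp
  qed
  have L_mono: "L i \<le> L j" if "i \<le> j" for i j
    using that by (induction rule: int_ge_induct) (use L_step order_trans in blast)+
  show thesis
  proof (cases "\<exists>i. L (i + 1) \<le> L i")
    case True
    then obtain i where i: "L (i + 1) = L i" using L_step antisym by blast
    \<comment> \<open>The first row ending in this column is taken, so that all rows above it end
      strictly earlier.\<close>
    let ?S = "{p. p \<le> i \<and> L p = L i}"
    have fin: "finite ?S"
      by (rule finite_subset[of _ "{L i - w..i}"]) (use L_le in \<open>auto simp: algebra_simps\<close>, metis)
    define p where "p = Min ?S"
    have p: "p \<le> i" "L p = L i" using Min_in[OF fin] unfolding p_def by auto
    have "L (p - 1) \<noteq> L i" using Min_le[OF fin, of "p - 1"] p unfolding p_def by auto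
    then have lt: "L (p - 1) < L i" using L_mono[of "p - 1" p] p by simp
    have p1: "L (p + 1) = L i"
      using L_mono[of p "p + 1"] L_mono[of "p + 1" "i + 1"] p i by simp
    show thesis
    proof (rule that[of p "L i"])
      show "y p (L i) > 0" using L(1)[of p] p pos by simp
      show "y (p + 1) (L i) > 0" using L(1)[of "p + 1"] p1 pos by simp
      show "y r j = 0" if "r < p" "L i \<le> j" for r j
        using L_mono[of r "p - 1"] that lt L(2)[of r j] by force
      show "y p j = 0" if "L i < j" for j using L(2)[of p j] that p by force
      show "y (p + 1) j = 0" if "L i < j" for j using L(2)[of "p + 1" j] that p1 by force
    qed
  next
    case False
    then have strict: "L i < L (i + 1)" for i by (simp add: not_le)
    \<comment> \<open>From i + 1 to i + n the last column moves by at least n - 1, while periodicity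
      allows at most n from i to i + n. So each single step is exactly 1.\<close>
    have grow: "L i + int m \<le> L (i + int m)" for i m
    proof (induction m)
      case (Suc m)
      then show ?case using strict[of "i + int m"] by (simp add: algebra_simps)
    qed simp
    have L_n: "L (i + int n) \<le> L i + int n" for i
      using L(1)[of "i + int n"] L(2)[of i "L (i + int n) - int n"]
        y(1)[unfolded periodic_def, rule_format, of i "L (i + int n) - int n"] by simp
    have "L (i + 1) \<le> L i + 1" for i
      using grow[of "i + 1" "n - 1"] L_n[of i] n by (simp add: of_nat_diff)
    then have L_Suc: "L (i + 1) = L i + 1" for i using strict[of i] by (simp add: order_antisym)
    have L_eq: "L i = L 0 + i" for i
    proof (induction i rule: int_induct[where k = 0])
      case (step2 i)
      then show ?case using L_Suc[of "i - 1"] by simp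
    qed (use L_Suc in auto)
    \<comment> \<open>In this entry of the product only the outermost entries of v and y meet: y
      vanishes for k < \<open>M 0\<close> and v for k > \<open>M 0\<close>. The entry is nonzero, so
      it must lie on the diagonal.\<close>
    have "(\<Sum>k\<in>{0..M 0 + L 0}. v 0 k * y k (M 0 + L 0)) = (\<Sum>k\<in>{M 0}. v 0 k * y k (M 0 + L 0))"
    proof (rule sum.mono_neutral_right)
      have "v 0 k * y k (M 0 + L 0) = 0" if "k \<noteq> M 0" for k
        using M(2)[of 0 k] L(2)[of k "M 0 + L 0"] L_eq[of k] that by (cases "k < M 0") auto
      then show "\<forall>k\<in>{0..M 0 + L 0} - {M 0}. v 0 k * y k (M 0 + L 0) = 0" by auto
      show "{M 0} \<subseteq> {0..M 0 + L 0}" using M(2)[of 0 0] v(2) L_ge[of 0] by auto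
    qed simp
    also have "\<dots> \<noteq> 0" using M(1)[of 0] L(1)[of "M 0"] L_eq[of "M 0"] by (simp add: add.commute)
    finally have "M 0 + L 0 = 0" unfolding inv by (simp split: if_splits)
    then have "L 0 = 0" using M(2)[of 0 0] v(2) L_ge[of 0] by auto
    then have "y i j = 0" if "i < j" for i j using L(2)[of i j] L_eq[of i] that by auto
    then have "y a b = (if a = b then 1 else 0)" using low[of b a] diag by (cases a b rule: linorder_cases) auto
    with nontriv show thesis by blast
  qed
qed

text \<open>Induction on the number of nonzero entries in one period of rows. Elimination only
  lowers entries and keeps them nonnegative, so zeros stay zeros, and the entry at (p, l) becomes a
  new one. The left inverse is carried along as \<open>V * ?e\<close>.\<close>

lemma tnn_banded_factorization:
  assumes n: "n \<ge> 2" and "Y \<in> unitri n" "tnn (unfolding_of n Y)" "banded (unfolding_of n Y)"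
    and "V \<in> unitri n" "banded (unfolding_of n V)" "V * Y = 1\<^sub>m n"
  shows "\<exists>is as. set is \<subseteq> {0..<int n} \<and> length is = length as \<and> (\<forall>a\<in>set as. 0 < a) \<and> Y = chevalley_word n is as"
  using assms(2-)
proof (induction "card {(i, j). i \<in> {1..int n} \<and> unfolding_of n Y i j \<noteq> 0}" arbitrary: Y V rule: less_induct)
  case less
  let ?y = "unfolding_of n Y" and ?v = "unfolding_of n V"
  have n0: "n > 0" using n by simp
  have y: "\<And>i. ?y i i = 1" "\<And>i j. j < i \<Longrightarrow> ?y i j = 0" and v: "\<And>i. ?v i i = 1" "\<And>i j. j < i \<Longrightarrow> ?v i j = 0"
    using less.prems by (auto simp: unitri_def)
  show ?case
  proof (cases "Y = 1\<^sub>m n")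
    case True
    then show ?thesis by (intro exI[of _ "[]"]) simp
  next
    case False
    then have "?y \<noteq> unfolding_of n (1\<^sub>m n)"
      using unfolding_inject[of Y n "1\<^sub>m n"] less.prems(1) by (auto simp: unitri_def)
    then obtain a b where ab: "?y a b \<noteq> (if a = b then 1 else 0)"
      using unfolding_one[OF n0] by (metis ext)
    have inv: "(\<Sum>k\<in>{i..j}. ?v i k * ?y k j) = (if i = j then 1 else 0)" for i j
      using unfolding_mult[OF n0 less.prems(4,1), of i j] less.prems(6) unfolding_one[OF n0] by simp
    obtain p l where pl: "?y p l > 0" "?y (p + 1) l > 0" "\<And>r j. r < p \<Longrightarrow> l \<le> j \<Longrightarrow> ?y r j = 0"
      "\<And>j. l < j \<Longrightarrow> ?y p j = 0" "\<And>j. l < j \<Longrightarrow> ?y (p + 1) j = 0"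
      by (rule exists_reducible_row[OF n periodic_unfolding[OF n0] less.prems(2,3) y less.prems(5) v inv ab]) (assumption | (erule that; simp))+
    define c where "c = ?y p l / ?y (p + 1) l"
    have c: "c > 0" using pl by (simp add: c_def)
    let ?f = "chevalley n p (- c)" and ?e = "chevalley n p c"
    let ?Y = "?f * Y" and ?V = "V * ?e"
    let ?y' = "unfolding_of n ?Y"
    have car: "Y \<in> carrier_mat n n" "V \<in> carrier_mat n n" "?e \<in> carrier_mat n n" "?f \<in> carrier_mat n n"
      using less.prems by (auto simp: unitri_def chevalley_carrier)
    have y'_eq: "?y' r j = ?y r j - (if r mod int n = p mod int n then c * ?y (r + 1) j else 0)" for r j
      using unfolding_chevalley_mult[OF n less.prems(1), of p "- c" r j] by simp
    have tnn': "tnn ?y'"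
      using tnn_subtract_periodic[OF n less.prems(2) periodic_unfolding[OF n0] pl(2-5)]
      unfolding c_def[symmetric] y'_eq[abs_def] by simp
    have le: "?y' r j \<le> ?y r j" for r j
      unfolding y'_eq using c tnn_nonneg[OF less.prems(2), of "r + 1" j] by simp
    have zero: "?y' r j = 0" if "?y r j = 0" for r j
      using le[of r j] tnn_nonneg[OF tnn', of r j] that by simp
    have unitri': "?Y \<in> unitri n" "?V \<in> unitri n"
      using less.prems n by (auto intro: unitri_mult unitri_chevalley)
    have banded': "banded ?y'" "banded (unfolding_of n ?V)"
      using less.prems n by (auto intro!: banded_mult banded_chevalley unitri_chevalley)
    have ef: "?e * ?f = 1\<^sub>m n" using chevalley_inverse[OF n, of p c] .
    have "?V * ?Y = V * (?e * ?Y)" using car by (intro assoc_mult_mat[of _ n n _ n _ n]) auto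
    also have e_Y: "?e * ?Y = Y"
      using car ef assoc_mult_mat[of ?e n n ?f n Y n] by simp
    finally have inv': "?V * ?Y = 1\<^sub>m n" using less.prems by simp
    let ?S = "\<lambda>x :: int \<Rightarrow> int \<Rightarrow> real. {(i, j). i \<in> {1..int n} \<and> x i j \<noteq> 0}"
    have "?S ?y' \<subset> ?S ?y"
    proof
      show "?S ?y' \<subseteq> ?S ?y" using zero by auto
      \<comment> \<open>The row congruent to p among 1, ..., n; the cleared entry is counted through
        its translate in this row.\<close>
      define q where "q = (p - 1) mod int n + 1"
      have q: "q mod int n = p mod int n" "q \<in> {1..int n}"
        using n pos_mod_bound[of "int n" "p - 1"] by (auto simp: q_def mod_simps add1_zle_eq)
      have "?y q (l + q - p) = ?y p l" "?y' q (l + q - p) = ?y' p l"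
        using periodic_mod_eq[OF periodic_unfolding[OF n0] q(1), of Y "l + q - p"]
          periodic_mod_eq[OF periodic_unfolding[OF n0] q(1), of ?Y "l + q - p"] by simp_all
      moreover have "c * ?y (p + 1) l = ?y p l" using pl by (simp add: c_def)
      then have "?y' p l = 0" by (simp add: y'_eq)
      ultimately have "(q, l + q - p) \<in> ?S ?y - ?S ?y'" using q pl by simp
      then show "?S ?y' \<noteq> ?S ?y" by blast
    qed
    moreover have "finite (?S ?y)"
    proof -
      obtain b where b: "\<And>i j. i + b < j \<Longrightarrow> ?y i j = 0" using less.prems(3) unfolding banded_def by blast
      have "?S ?y \<subseteq> {1..int n} \<times> {1..int n + b}"
      proof clarsimp
        fix i j assume "1 \<le> i" "i \<le> int n" "?y i j \<noteq> 0"
        then show "1 \<le> j \<and> j \<le> int n + b" using y(2)[of j i] b[of i j] by force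
      qed
      then show ?thesis by (rule finite_subset) simp
    qed
    ultimately have "card (?S ?y') < card (?S ?y)" by (intro psubset_card_mono)
    from less.hyps[OF this unitri'(1) tnn' banded'(1) unitri'(2) banded'(2) inv']
    obtain "is" as where w: "set is \<subseteq> {0..<int n}" "length is = length as" "\<forall>a\<in>set as. 0 < a" "?Y = chevalley_word n is as"
      by blast
    \<comment> \<open>Letters of words have to lie in 0, ..., n - 1, and a generator depends only on
      the residue of its index.\<close>
    have "chevalley n (p mod int n) c = ?e" by (simp only: chevalley_def mod_mod_trivial)
    then show ?thesis
      using w c n e_Y by (intro exI[of _ "(p mod int n) # is"] exI[of _ "c # as"]) auto
  qed
qed

section \<open>Simple generators and braid relations\<close>

lemma add_mod_neq:
  assumes "0 < d" "d < int n"
  shows "(k + d) mod int n \<noteq> k mod int n"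
proof
  assume "(k + d) mod int n = k mod int n"
  then have "int n dvd d" by (metis add_diff_cancel_left' mod_eq_dvd_iff)
  then show False using assms zdvd_imp_le by fastforce
qed

lemma mod_add_left_eq_iff:
  "(k + d) mod int n = (l + d) mod int n \<longleftrightarrow> k mod int n = l mod int n" for k l d :: int
  by (simp add: mod_eq_dvd_iff)

lemma simple_gen_cong: "i mod int n = j mod int n \<Longrightarrow> simple_gen n i = simple_gen n j"
  using mod_add_left_eq_iff[of i 1 n j] by (simp add: simple_gen_def fun_eq_iff)

lemma simple_gen_left [simp]: "simple_gen n i i = i + 1"
  by (simp add: simple_gen_def)

lemma simple_gen_right [simp]: "n \<ge> 2 \<Longrightarrow> simple_gen n i (i + 1) = i"
  using add_mod_neq[of 1 n i] by (simp add: simple_gen_def)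

lemma simple_gen_fix:
  assumes "k mod int n \<noteq> i mod int n" "k mod int n \<noteq> (i + 1) mod int n"
  shows "simple_gen n i k = k"
  using assms by (simp add: simple_gen_def)

lemma simple_gen_fix_above: "i + 1 < k \<Longrightarrow> k < i + int n \<Longrightarrow> simple_gen n i k = k"
  using add_mod_neq[of "k - i" n i] add_mod_neq[of "k - (i + 1)" n "i + 1"]
  by (intro simple_gen_fix) auto

lemma simple_gen_fix_below: "i + 1 < k + int n \<Longrightarrow> k < i \<Longrightarrow> simple_gen n i k = k"
  using add_mod_neq[of "i - k" n k] add_mod_neq[of "i + 1 - k" n k]
  by (intro simple_gen_fix) auto

lemma simple_gen_shift: "simple_gen n i (k + int n) = simple_gen n i k + int n"
  by (simp add: simple_gen_def)

text \<open>Any n consecutive integers determine such a map. The start i is free, so identities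
  between generators can be checked on a window in which the moved pairs do not wrap around.\<close>

lemma equivariant_eqI:
  fixes f g :: "int \<Rightarrow> int"
  assumes n: "n > 0" and f: "\<And>k. f (k + int n) = f k + int n" and g: "\<And>k. g (k + int n) = g k + int n"
    and eq: "\<And>k. i \<le> k \<Longrightarrow> k < i + int n \<Longrightarrow> f k = g k"
  shows "f = g"
proof
  have shift: "h (k + t * int n) = h k + t * int n"
    if h: "\<And>k. h (k + int n) = h k + int n" for h :: "int \<Rightarrow> int" and k t
  proof (induction t rule: int_induct[where k = 0])
    case (step1 t)
    then show ?case using h[of "k + t * int n"] by (simp add: algebra_simps)
  next
    case (step2 t)
    then show ?case using h[of "k + (t - 1) * int n"] by (simp add: algebra_simps)
  qed simp
  fix k
  let ?k = "i + (k - i) mod int n" and ?t = "(k - i) div int n"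
  have k: "k = ?k + ?t * int n" using div_mult_mod_eq[of "k - i" "int n"] by linarith
  have "f ?k = g ?k" using n by (intro eq) auto
  then show "f k = g k" using shift[of f ?k ?t, OF f] shift[of g ?k ?t, OF g] unfolding k[symmetric] by simp
qed

lemma simple_gen_involutive:
  assumes "n \<ge> 2"
  shows "simple_gen n i \<circ> simple_gen n i = id"
proof (rule equivariant_eqI[where n = n and i = i])
  fix k assume "i \<le> k" "k < i + int n"
  then consider "k = i" | "k = i + 1" | "i + 1 < k" "k < i + int n" by linarith
  then show "(simple_gen n i \<circ> simple_gen n i) k = id k"
    by cases (use assms in \<open>auto simp: simple_gen_fix_above\<close>)
qed (use assms in \<open>auto simp: simple_gen_shift\<close>)

lemma simple_gen_commute:
  assumes "n \<ge> 2" "i + 1 < j" "j + 1 < i + int n"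
  shows "simple_gen n i \<circ> simple_gen n j = simple_gen n j \<circ> simple_gen n i"
proof (rule equivariant_eqI[where n = n and i = i])
  fix k assume "i \<le> k" "k < i + int n"
  then consider "k = i" | "k = i + 1" | "k = j" | "k = j + 1" | "i + 1 < k" "k < j" | "j + 1 < k" "k < i + int n" by linarith
  then show "(simple_gen n i \<circ> simple_gen n j) k = (simple_gen n j \<circ> simple_gen n i) k"
    by cases (use assms in \<open>auto simp: simple_gen_fix_above simple_gen_fix_below\<close>)
qed (use assms in \<open>auto simp: simple_gen_shift\<close>)

lemma simple_gen_braid:
  assumes "n \<ge> 3"
  shows "simple_gen n i \<circ> simple_gen n (i + 1) \<circ> simple_gen n i
    = simple_gen n (i + 1) \<circ> simple_gen n i \<circ> simple_gen n (i + 1)"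
proof (rule equivariant_eqI[where n = n and i = i])
  have [simp]: "simple_gen n (i + 1) (2 + i) = i + 1" "simple_gen n (i + 1) (i + 2) = i + 1" "simple_gen n (i + 1) (i + 1) = i + 2"
    using simple_gen_right[of n "i + 1"] simple_gen_left[of n "i + 1"] assms by (simp_all add: algebra_simps del: simple_gen_right simple_gen_left)
  fix k assume "i \<le> k" "k < i + int n"
  then consider "k = i" | "k = i + 1" | "k = i + 2" | "i + 2 < k" "k < i + int n" by linarith
  then show "(simple_gen n i \<circ> simple_gen n (i + 1) \<circ> simple_gen n i) k
      = (simple_gen n (i + 1) \<circ> simple_gen n i \<circ> simple_gen n (i + 1)) k"
    by cases (use assms in \<open>auto simp: simple_gen_fix_above simple_gen_fix_below\<close>)
qed (use assms in \<open>auto simp: simple_gen_shift\<close>)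

section \<open>Affine permutations and window sums\<close>

lemma sum_window:
  fixes f :: "int \<Rightarrow> int"
  assumes "\<And>k. f (k + int n) = f k" and n: "n > 0"
  shows "sum f {a..<a + int n} = sum f {0..<int n}"
proof -
  have step: "sum f {a + 1..<a + 1 + int n} = sum f {a..<a + int n}" for a
  proof -
    have "{a..<a + int n} = insert a {a + 1..<a + int n}"
      "{a + 1..<a + 1 + int n} = insert (a + int n) {a + 1..<a + int n}" using n by auto
    then show ?thesis using assms(1)[of a] by simp
  qed
  show ?thesis
  proof (induction a rule: int_induct[where k = 0])
    case (step2 a)
    then show ?case using step[of "a - 1"] by simp
  qed (use step in auto)
qed

text \<open>\<open>w k - k\<close> is periodic, so its sum over n consecutive integers does not
  depend on where they start. The window starting at i is mapped to itself by
  \<open>simple_gen n i\<close>.\<close>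

lemma affine_sym_sum_iff:
  assumes "n > 0" and "\<And>k. w (k + int n) = w k + int n"
  shows "(\<Sum>k = 1..int n. w k) = (\<Sum>k = 1..int n. k) \<longleftrightarrow> (\<Sum>k\<in>{a..<a + int n}. w k) = (\<Sum>k\<in>{a..<a + int n}. k)"
proof -
  have "{1..int n} = {1..<1 + int n}" by auto
  then show ?thesis
    using sum_window[of "\<lambda>k. w k - k" n a] sum_window[of "\<lambda>k. w k - k" n 1] assms
    by (simp add: sum_subtractf) (metis eq_iff_diff_eq_0)
qed

lemma affine_sym_comp_simple_gen:
  assumes n: "n \<ge> 2" and w: "w \<in> affine_sym n"
  shows "w \<circ> simple_gen n i \<in> affine_sym n"
proof -
  let ?s = "simple_gen n i"
  have bij_s: "bij ?s" using simple_gen_involutive[OF n, of i] o_bij by blast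
  have w': "bij w" "\<And>k. w (k + int n) = w k + int n" using w by (auto simp: affine_sym_def)
  have s_in: "?s k \<in> {i..<i + int n}" if "k \<in> {i..<i + int n}" for k
  proof -
    from that consider "k = i" | "k = i + 1" | "i + 1 < k" "k < i + int n" by fastforce
    then show ?thesis by cases (use n that in \<open>auto simp: simple_gen_fix_above\<close>)
  qed
  have "(\<Sum>k\<in>{i..<i + int n}. (w \<circ> ?s) k) = (\<Sum>k\<in>{i..<i + int n}. w k)"
    by (rule sum.reindex_bij_witness[of _ ?s ?s])
      (use s_in simple_gen_involutive[OF n, of i] in \<open>auto simp: fun_eq_iff\<close>)
  also have "\<dots> = (\<Sum>k\<in>{i..<i + int n}. k)"
    using w n affine_sym_sum_iff[of n w i] w'(2) by (simp add: affine_sym_def)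
  finally show ?thesis
    using affine_sym_sum_iff[of n "w \<circ> ?s" i] n w' bij_s
    by (simp add: affine_sym_def simple_gen_shift bij_comp)
qed

lemma id_affine_sym: "id \<in> affine_sym n"
  by (simp add: affine_sym_def)

lemma affine_sym_shift:
  assumes "w \<in> affine_sym n"
  shows "w (k + t * int n) = w k + t * int n"
proof (induction t rule: int_induct[where k = 0])
  case (step1 t)
  have "w (k + t * int n + int n) = w (k + t * int n) + int n" using assms by (simp add: affine_sym_def)
  then show ?case using step1 by (simp add: algebra_simps)
next
  case (step2 t)
  have "w (k + (t - 1) * int n + int n) = w (k + (t - 1) * int n) + int n" using assms by (simp add: affine_sym_def)
  then show ?case using step2 by (simp add: algebra_simps)
qed simp

lemma affine_sym_ascent_cong:
  assumes "w \<in> affine_sym n" "i mod int n = j mod int n"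
  shows "w i < w (i + 1) \<longleftrightarrow> w j < w (j + 1)"
proof -
  have "int n dvd i - j" using assms(2) by (simp add: mod_eq_dvd_iff)
  then obtain t where "i - j = int n * t" by (elim dvdE)
  then have i: "i = j + t * int n" by (simp add: algebra_simps)
  then show ?thesis
    using affine_sym_shift[OF assms(1), of j t] affine_sym_shift[OF assms(1), of "j + 1" t]
    by (simp add: algebra_simps)
qed

text \<open>Right multiplication by \<open>chevalley n i a\<close>, expressed as a column operation
  on unfoldings.\<close>

definition elem_step :: "nat \<Rightarrow> int \<Rightarrow> real \<Rightarrow> (int \<Rightarrow> int \<Rightarrow> real) \<Rightarrow> int \<Rightarrow> int \<Rightarrow> real" where
  "elem_step n i a x = (\<lambda>p q. x p q + (if (q - 1) mod int n = i mod int n then a * x p (q - 1) else 0))"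

lemma elem_step_cong: "i mod int n = j mod int n \<Longrightarrow> elem_step n i = elem_step n j"
  by (simp add: elem_step_def fun_eq_iff)

lemma elem_step_add:
  assumes "n \<ge> 2"
  shows "elem_step n i a (elem_step n i b x) = elem_step n i (a + b) x"
proof (intro ext)
  fix p q
  have "(q - 1 - 1) mod int n \<noteq> (q - 1) mod int n" using add_mod_neq[of 1 n "q - 1 - 1"] assms by simp
  then show "elem_step n i a (elem_step n i b x) p q = elem_step n i (a + b) x p q"
    by (auto simp: elem_step_def algebra_simps)
qed

lemma elem_step_commute:
  assumes "(i + 1) mod int n \<noteq> j mod int n" "(j + 1) mod int n \<noteq> i mod int n"
  shows "elem_step n i a (elem_step n j b x) = elem_step n j b (elem_step n i a x)"
proof (intro ext)
  fix p q
  have "(q - 1 - 1) mod int n = k mod int n \<longleftrightarrow> (q - 1) mod int n = (k + 1) mod int n" for k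
    using mod_add_left_eq_iff[of "q - 1 - 1" 1 n k] by simp
  then show "elem_step n i a (elem_step n j b x) p q = elem_step n j b (elem_step n i a x) p q"
    using assms by (auto simp: elem_step_def)
qed

text \<open>Comparing coefficients in the affected columns leaves the identities
  \<open>b = B + C\<close>, \<open>b * c = B * d\<close> and \<open>a * b = d * C\<close> with
  \<open>d = a + c\<close>. The new parameters are again positive, so the rewritten steps stay
  admissible in \<open>asc_cell\<close>. The innermost step is the leftmost factor of the matrix
  product.\<close>

lemma elem_step_braid:
  assumes n: "n \<ge> 3" and "a > 0" "b > 0" "c > 0"
  shows "elem_step n i a (elem_step n (i + 1) b (elem_step n i c x))
      = elem_step n (i + 1) (b * c / (a + c)) (elem_step n i (a + c) (elem_step n (i + 1) (a * b / (a + c)) x))"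
    and "elem_step n (i + 1) a (elem_step n i b (elem_step n (i + 1) c x))
      = elem_step n i (b * c / (a + c)) (elem_step n (i + 1) (a + c) (elem_step n i (a * b / (a + c)) x))"
proof -
  define d B C where d: "d = a + c" and B: "B = b * c / (a + c)" and C: "C = a * b / (a + c)"
  have "a + c \<noteq> 0" using assms by simp
  moreover have "B + C = b * (a + c) / (a + c)"
    unfolding B C add_divide_distrib[symmetric] by (simp add: algebra_simps)
  ultimately have BC: "b = B + C" "b * c = B * d" "a * b = d * C"
    by (simp, simp_all add: d B C)
  have res: "(q - 2) mod int n = k mod int n \<longleftrightarrow> (q - 1) mod int n = (k + 1) mod int n"
    "(q - 3) mod int n = k mod int n \<longleftrightarrow> (q - 1) mod int n = (k + 2) mod int n" for q k
    using mod_add_left_eq_iff[of "q - 2" 1 n k] mod_add_left_eq_iff[of "q - 3" 2 n k] by simp_all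
  have ne: "(k + 1) mod int n \<noteq> k mod int n" "(k + 2) mod int n \<noteq> k mod int n"
    "(k + 2) mod int n \<noteq> (k + 1) mod int n" "(k + 3) mod int n \<noteq> (k + 1) mod int n"  for k
    using add_mod_neq[of 1 n k] add_mod_neq[of 2 n k] add_mod_neq[of 1 n "k + 1"] add_mod_neq[of 2 n "k + 1"] n
    by (simp_all add: add.assoc)
  note ne = ne ne[symmetric]
  have ne2: "i mod int n \<noteq> (2 + i) mod int n" "(i + 1) mod int n \<noteq> (2 + i) mod int n"
    "(i + 1) mod int n \<noteq> (3 + i) mod int n"
    using ne(6)[of i] ne(7)[of i] ne(8)[of i] unfolding add.commute[of 2] add.commute[of 3] .
  have *: "elem_step n i a (elem_step n (i + 1) b (elem_step n i c x)) p q
      = elem_step n (i + 1) B (elem_step n i d (elem_step n (i + 1) C x)) p q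
    \<and> elem_step n (i + 1) a (elem_step n i b (elem_step n (i + 1) c x)) p q
      = elem_step n i B (elem_step n (i + 1) d (elem_step n i C x)) p q" for p q
  proof -
    consider "(q - 1) mod int n = i mod int n" | "(q - 1) mod int n = (i + 1) mod int n"
      | "(q - 1) mod int n \<noteq> i mod int n" "(q - 1) mod int n \<noteq> (i + 1) mod int n" by blast
    then show ?thesis
    proof cases
      case 1
      then show ?thesis by (simp add: elem_step_def res ne ne2) (simp add: d BC(1) distrib_right)
    next
      case 2
      then have "elem_step n i a (elem_step n (i + 1) b (elem_step n i c x)) p q = x p q + b * (x p (q - 1) + c * x p (q - 2))"
        "elem_step n (i + 1) B (elem_step n i d (elem_step n (i + 1) C x)) p q = x p q + C * x p (q - 1) + B * (x p (q - 1) + d * x p (q - 2))"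
        "elem_step n (i + 1) a (elem_step n i b (elem_step n (i + 1) c x)) p q = x p q + c * x p (q - 1) + a * (x p (q - 1) + b * x p (q - 2))"
        "elem_step n i B (elem_step n (i + 1) d (elem_step n i C x)) p q = x p q + d * (x p (q - 1) + C * x p (q - 2))"
        by (simp_all add: elem_step_def res ne ne2)
      moreover have "b * (y + c * z) = C * y + B * (y + d * z)" for y z
        by (simp add: distrib_left mult.assoc[symmetric] BC(2)) (simp add: BC(1) distrib_right)
      moreover have "c * y + a * (y + b * z) = d * (y + C * z)" for y z
        by (simp add: distrib_left mult.assoc[symmetric] BC(3)) (simp add: d distrib_right)
      ultimately show ?thesis by simp
    next
      case 3
      then show ?thesis by (simp add: elem_step_def)
    qed
  qed
  from * show "elem_step n i a (elem_step n (i + 1) b (elem_step n i c x))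
      = elem_step n (i + 1) (b * c / (a + c)) (elem_step n i (a + c) (elem_step n (i + 1) (a * b / (a + c)) x))"
    unfolding B[symmetric] C[symmetric] unfolding d[symmetric] by (intro ext) blast
  from * show "elem_step n (i + 1) a (elem_step n i b (elem_step n (i + 1) c x))
      = elem_step n i (b * c / (a + c)) (elem_step n (i + 1) (a + c) (elem_step n i (a * b / (a + c)) x))"
    unfolding B[symmetric] C[symmetric] unfolding d[symmetric] by (intro ext) blast
qed

section \<open>Cells as chains of ascents\<close>

text \<open>The index i ranges over all integers, so a convenient representative of a letter can be
  used. The counter k turns out to be the length of v.\<close>

inductive asc_cell :: "nat \<Rightarrow> nat \<Rightarrow> (int \<Rightarrow> int) \<Rightarrow> (int \<Rightarrow> int \<Rightarrow> real) \<Rightarrow> bool" for n where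
  asc_id: "asc_cell n 0 id (\<lambda>p q. if p = q then 1 else 0)"
| asc_step: "asc_cell n k v x \<Longrightarrow> v i < v (i + 1) \<Longrightarrow> 0 < a \<Longrightarrow>
    asc_cell n (Suc k) (v \<circ> simple_gen n i) (elem_step n i a x)"

lemma asc_cell_affine_sym:
  assumes "n \<ge> 2" "asc_cell n k v x"
  shows "v \<in> affine_sym n"
  using assms(2) by induction (rule id_affine_sym, erule affine_sym_comp_simple_gen[OF assms(1)])

lemma affine_sym_inj: "w \<in> affine_sym n \<Longrightarrow> w i = w j \<Longrightarrow> i = j"
  by (auto simp: affine_sym_def bij_def inj_def)

section \<open>Linear dependencies between truncated columns\<close>

interpretation funspace: vector_space "\<lambda>(c::real) (f::int \<Rightarrow> real) r. c * f r"
  by unfold_locales (auto simp: fun_eq_iff algebra_simps)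

text \<open>Here t and u are adjacent columns q - 1 and q, and S consists of the columns after q.
  Adding a multiple of t to u exchanges the dependency conditions of the two columns, as composing
  with a simple generator exchanges two values of v. The condition \<open>imp\<close> is what the
  ascent of v provides.\<close>

lemma (in vector_space) span_insert_combination_iff:
  assumes a: "a \<noteq> 0" and imp: "t \<in> span (insert u S) \<Longrightarrow> u \<in> span S"
  shows "u + scale a t \<in> span S \<longleftrightarrow> t \<in> span (insert u S)"
    and "t \<in> span (insert (u + scale a t) S) \<longleftrightarrow> u \<in> span S"
proof -
  have t: "t = scale (inverse a) ((u + scale a t) - u)" using a by simp
  show "u + scale a t \<in> span S \<longleftrightarrow> t \<in> span (insert u S)"
  proof
    assume "u + scale a t \<in> span S"
    then have "u + scale a t \<in> span (insert u S)" using span_mono[of S "insert u S"] by blast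
    then have "scale (inverse a) ((u + scale a t) - u) \<in> span (insert u S)"
      by (rule span_scale[OF span_diff[OF _ span_base[OF insertI1]]])
    then show "t \<in> span (insert u S)" unfolding t[symmetric] .
  next
    assume "t \<in> span (insert u S)"
    then have "u \<in> span S" "t \<in> span S" using imp span_redundant[of u S] by auto
    then show "u + scale a t \<in> span S" by (intro span_add span_scale)
  qed
  show "t \<in> span (insert (u + scale a t) S) \<longleftrightarrow> u \<in> span S"
  proof
    assume "u \<in> span S"
    then have "u \<in> span (insert (u + scale a t) S)" using span_mono[of S "insert (u + scale a t) S"] by blast
    then have "scale (inverse a) ((u + scale a t) - u) \<in> span (insert (u + scale a t) S)"
      by (rule span_scale[OF span_diff[OF span_base[OF insertI1]]])
    then show "t \<in> span (insert (u + scale a t) S)" unfolding t[symmetric] .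
  next
    assume "t \<in> span (insert (u + scale a t) S)"
    then obtain k where "t - scale k (u + scale a t) \<in> span S" by (auto simp: span_insert)
    then have k: "scale (1 - k * a) t - scale k u \<in> span S"
      by (simp add: algebra_simps scale_left_diff_distrib scale_right_distrib)
    \<comment> \<open>If the coefficient of t is 0, then k is nonzero and the relation puts u into
      the span; otherwise it expresses t through u and S, and \<open>imp\<close> applies.\<close>
    show "u \<in> span S"
    proof (cases "1 - k * a = 0")
      case True
      then have "k \<noteq> 0" by auto
      have "scale k u \<in> span S" using k span_neg[of "- scale k u" S] by (simp add: True)
      then show ?thesis using span_scale[of "scale k u" S "inverse k"] \<open>k \<noteq> 0\<close> by simp
    next
      case False
      have "scale (inverse (1 - k * a)) (scale (1 - k * a) t - scale k u) \<in> span S"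
        using k by (rule span_scale)
      then have "t - scale (inverse (1 - k * a) * k) u \<in> span S"
        using False by (simp add: scale_right_diff_distrib)
      then show ?thesis by (intro imp) (auto simp: span_insert)
    qed
  qed
qed

definition trunc_col :: "int \<Rightarrow> (int \<Rightarrow> int \<Rightarrow> real) \<Rightarrow> int \<Rightarrow> int \<Rightarrow> real" where
  "trunc_col p x q = (\<lambda>r. if r \<le> p then x r q else 0)"

abbreviation later_span :: "int \<Rightarrow> (int \<Rightarrow> int \<Rightarrow> real) \<Rightarrow> int \<Rightarrow> (int \<Rightarrow> real) set" where
  "later_span p x q \<equiv> funspace.span (trunc_col p x ` {q<..})"

lemma trunc_col_elem_step:
  "trunc_col p (elem_step n i a x) q = trunc_col p x q +
    (if (q - 1) mod int n = i mod int n then (\<lambda>r. a * trunc_col p x (q - 1) r) else 0)"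
  by (auto simp: trunc_col_def elem_step_def fun_eq_iff)

text \<open>If q is not in the class of i, each column after q that changes receives a multiple of a
  column that is itself after q and unchanged, so the operation can be undone within the later
  columns.\<close>

lemma later_span_elem_step:
  assumes n: "n \<ge> 2" and q: "q mod int n \<noteq> i mod int n"
  shows "later_span p (elem_step n i a x) q = later_span p x q"
proof (intro equalityI funspace.span_minimal funspace.subspace_span)
  show "trunc_col p (elem_step n i a x) ` {q<..} \<subseteq> later_span p x q"
  proof clarify
    fix j assume "q < j"
    have "(\<lambda>r. a * trunc_col p x (j - 1) r) \<in> later_span p x q" if "(j - 1) mod int n = i mod int n"
      using that q \<open>q < j\<close> by (intro funspace.span_scale funspace.span_base imageI) (cases "q = j - 1", auto)
    then show "trunc_col p (elem_step n i a x) j \<in> later_span p x q"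
      unfolding trunc_col_elem_step using \<open>q < j\<close>
      by (intro funspace.span_add) (auto intro: funspace.span_base funspace.span_zero)
  qed
  show "trunc_col p x ` {q<..} \<subseteq> later_span p (elem_step n i a x) q"
  proof clarify
    fix j assume "q < j"
    show "trunc_col p x j \<in> later_span p (elem_step n i a x) q"
    proof (cases "(j - 1) mod int n = i mod int n")
      case True
      then have "(j - 1 - 1) mod int n \<noteq> i mod int n"
        using add_mod_neq[of 1 n "j - 1 - 1"] n by simp
      then have eq: "trunc_col p x (j - 1) = trunc_col p (elem_step n i a x) (j - 1)"
        by (simp add: trunc_col_elem_step)
      have "trunc_col p x j = trunc_col p (elem_step n i a x) j - (\<lambda>r. a * trunc_col p (elem_step n i a x) (j - 1) r)"
        unfolding eq[symmetric] using True by (simp add: trunc_col_elem_step)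
      moreover have "q < j - 1" using True q \<open>q < j\<close> by (cases "q = j - 1") auto
      ultimately show ?thesis using \<open>q < j\<close>
        by (simp only:) (intro funspace.span_diff funspace.span_scale funspace.span_base imageI; simp)
    next
      case False
      then have "trunc_col p x j = trunc_col p (elem_step n i a x) j" by (simp add: trunc_col_elem_step)
      then show ?thesis using \<open>q < j\<close> by (auto intro: funspace.span_base)
    qed
  qed
qed

lemma trunc_col_image_insert:
  "trunc_col p x ` {q - 1<..} = insert (trunc_col p x q) (trunc_col p x ` {q<..})"
proof -
  have "{q - 1<..} = insert q {q<..}" by auto
  then show ?thesis by simp
qed

text \<open>The cell remembers its permutation: \<open>v q\<close> is the least \<open>p\<close> for which column \<open>q\<close>, cut off below
  row \<open>p\<close>, is independent of the later columns. This is the Bruhat decomposition with respect to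
  lower triangular matrices.\<close>

lemma asc_cell_later_span:
  assumes n: "n \<ge> 2" and "asc_cell n k v x"
  shows "trunc_col p x q \<in> later_span p x q \<longleftrightarrow> p < v q"
  using assms(2)
proof (induction arbitrary: q)
  case asc_id
  let ?x = "\<lambda>p q::int. if p = q then 1::real else 0"
  show ?case
  proof (cases "p < q")
    case True
    then have "trunc_col p ?x q = 0" by (auto simp: trunc_col_def fun_eq_iff)
    then show ?thesis using True by (simp only: funspace.span_zero id_apply)
  next
    case False
    \<comment> \<open>Evaluation at row q vanishes on all later columns of the identity, but not on
      column q.\<close>
    have "f q = 0" if "f \<in> later_span p ?x q" for f
      using that
    proof (induction rule: funspace.span_induct)
      case base
      then show ?case by (auto simp: funspace.subspace_def)
    qed (auto simp: trunc_col_def)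
    moreover have "trunc_col p ?x q q = 1" using False by (simp add: trunc_col_def)
    ultimately show ?thesis using False by fastforce
  qed
next
  case (asc_step k v x i a)
  let ?x = "elem_step n i a x" and ?v = "v \<circ> simple_gen n i"
  have v: "v \<in> affine_sym n" using asc_cell_affine_sym[OF n asc_step.hyps(1)] .
  have imp: "trunc_col p x (q - 1) \<in> funspace.span (insert (trunc_col p x q) (trunc_col p x ` {q<..}))
      \<Longrightarrow> trunc_col p x q \<in> later_span p x q" if "(q - 1) mod int n = i mod int n" for q
    using asc_step.IH[of "q - 1"] asc_step.IH[of q] asc_step.hyps(2) affine_sym_ascent_cong[OF v that]
    unfolding trunc_col_image_insert[symmetric] by simp
  \<comment> \<open>Column q receives a multiple of its predecessor, or is added to its successor
    (changing the later span), or is affected in neither way.\<close>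
  consider "(q - 1) mod int n = i mod int n" | "q mod int n = i mod int n"
    | "(q - 1) mod int n \<noteq> i mod int n" "q mod int n \<noteq> i mod int n" by blast
  then show ?case
  proof cases
    case 1
    then have q: "q mod int n \<noteq> i mod int n" using add_mod_neq[of 1 n "q - 1"] n by simp
    have "simple_gen n i q = q - 1"
      using simple_gen_right[OF n, of "q - 1"] simple_gen_cong[OF 1] by simp
    moreover have "trunc_col p ?x q = trunc_col p x q + (\<lambda>r. a * trunc_col p x (q - 1) r)"
      using 1 by (simp add: trunc_col_elem_step)
    moreover have "trunc_col p x q + (\<lambda>r. a * trunc_col p x (q - 1) r) \<in> later_span p x q \<longleftrightarrow>
        trunc_col p x (q - 1) \<in> funspace.span (insert (trunc_col p x q) (trunc_col p x ` {q<..}))"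
      by (rule funspace.span_insert_combination_iff(1)) (use asc_step.hyps(3) imp[OF 1] in simp_all)
    ultimately show ?thesis
      unfolding later_span_elem_step[OF n q] trunc_col_image_insert[symmetric]
      by (simp only: asc_step.IH comp_apply)
  next
    case 2
    then have q: "(q - 1) mod int n \<noteq> i mod int n" using add_mod_neq[of 1 n "q - 1"] n by simp
    have q1: "(q + 1) mod int n \<noteq> i mod int n" using add_mod_neq[of 1 n q] n 2 by simp
    have "simple_gen n i q = q + 1" using simple_gen_cong[OF 2, symmetric] by simp
    moreover have "trunc_col p ?x q = trunc_col p x q"
      using q by (simp add: trunc_col_elem_step)
    moreover have "later_span p ?x q = funspace.span (insert (trunc_col p x (q + 1) + (\<lambda>r. a * trunc_col p x q r)) (trunc_col p x ` {q + 1<..}))"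
    proof -
      have "trunc_col p ?x ` {q<..} = insert (trunc_col p x (q + 1) + (\<lambda>r. a * trunc_col p x q r)) (trunc_col p ?x ` {q + 1<..})"
        using trunc_col_image_insert[of p ?x "q + 1"] 2 by (simp add: trunc_col_elem_step)
      then show ?thesis
        using later_span_elem_step[OF n q1, of p a x] by (simp add: funspace.span_insert)
    qed
    moreover have "trunc_col p x q \<in> funspace.span (insert (trunc_col p x (q + 1) + (\<lambda>r. a * trunc_col p x q r)) (trunc_col p x ` {q + 1<..}))
        \<longleftrightarrow> trunc_col p x (q + 1) \<in> later_span p x (q + 1)"
      by (rule funspace.span_insert_combination_iff(2)) (use asc_step.hyps(3) imp[of "q + 1"] 2 in simp_all)
    ultimately show ?thesis
      by (simp only: asc_step.IH comp_apply)
  next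
    case 3
    have "q mod int n \<noteq> (i + 1) mod int n" using 3 mod_add_left_eq_iff[of "q - 1" 1 n i] by simp
    then have "simple_gen n i q = q" using 3 by (intro simple_gen_fix)
    moreover have "trunc_col p ?x q = trunc_col p x q" using 3 by (simp add: trunc_col_elem_step)
    ultimately show ?thesis
      by (simp only: later_span_elem_step[OF n 3(2)] asc_step.IH comp_apply)
  qed
qed

lemma asc_cell_disjoint:
  assumes "n \<ge> 2" "asc_cell n k v x" "asc_cell n m u x"
  shows "v = u"
proof
  fix q
  have "p < v q \<longleftrightarrow> p < u q" for p
    using asc_cell_later_span[OF assms(1,2), of p q] asc_cell_later_span[OF assms(1,3), of p q] by simp
  from this[of "u q"] this[of "v q"] show "v q = u q" by simp
qed

lemma comp_simple_gen_cancel: "n \<ge> 2 \<Longrightarrow> v \<circ> simple_gen n i \<circ> simple_gen n i = v"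
  by (simp add: comp_assoc simple_gen_involutive)

lemma asc_cell_not_eq:
  assumes "n \<ge> 2" "asc_cell n k v x"
  shows "v i < v (i + 1) \<or> v (i + 1) < v i"
  using affine_sym_inj[OF asc_cell_affine_sym[OF assms], of i "i + 1"] by fastforce

text \<open>A descent can be moved to the end of the word. This is Tits' argument for Matsumoto's theorem:
  two different descents are either commuting or part of a braid, and for \<open>n = 2\<close> they cannot
  coexist.\<close>

lemma asc_cell_descent:
  assumes n: "n \<ge> 2" and "asc_cell n k v x" "v (i + 1) < v i"
  shows "\<exists>k' b x'. k = Suc k' \<and> 0 < b \<and> asc_cell n k' (v \<circ> simple_gen n i) x' \<and> x = elem_step n i b x'"
  using assms(2,3)
proof (induction k arbitrary: v x i rule: less_induct)
  case (less k)
  from less.prems(1) show ?case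
  proof cases
    case asc_id
    then show ?thesis using less.prems(2) by simp
  next
    case (asc_step k0 v1 x1 j0 a)
    let ?s = "simple_gen n" and ?e = "elem_step n"
    \<comment> \<open>This representative of the last letter turns its position relative to i modulo
      n into an inequality between integers.\<close>
    define j where "j = i + (j0 - i) mod int n"
    have jj0: "j mod int n = j0 mod int n" by (simp add: j_def mod_simps)
    have j: "i \<le> j" "j < i + int n" using n by (auto simp: j_def)
    have v1: "v1 \<in> affine_sym n" using asc_cell_affine_sym[OF n asc_step(4)] .
    have v: "v = v1 \<circ> ?s j" and x: "x = ?e j a x1"
      using asc_step simple_gen_cong[OF jj0] elem_step_cong[OF jj0] by auto
    have asc_j: "v1 j < v1 (j + 1)" using asc_step affine_sym_ascent_cong[OF v1 jj0] by simp
    have v1_eq: "v1 = v \<circ> ?s j" unfolding v by (simp only: comp_simple_gen_cancel[OF n])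
    have desc_j: "v (j + 1) < v j" using asc_j n by (simp add: v)
    have "k0 < k" using asc_step(1) by simp
    note IH = less.IH[OF this asc_step(4)]
    \<comment> \<open>Used for both neighbours of i. The letters j', i, j' are peeled off the end by
      induction, the braid relation rewrites their steps as i, j', i, and the first two of these
      lead to the cell of \<open>v \<circ> ?s i\<close>.\<close>
    have braid: ?thesis
      if j': "j' mod int n = j mod int n"
        and comm: "?s j' \<circ> ?s i \<circ> ?s j' = ?s i \<circ> ?s j' \<circ> ?s i"
        and el: "\<And>a b c x. 0 < a \<Longrightarrow> 0 < b \<Longrightarrow> 0 < c \<Longrightarrow>
            ?e j' a (?e i b (?e j' c x)) = ?e i (b * c / (a + c)) (?e j' (a + c) (?e i (a * b / (a + c)) x))"
        and d1: "(v \<circ> ?s j') (i + 1) < (v \<circ> ?s j') i"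
        and d2: "(v \<circ> ?s j' \<circ> ?s i) (j' + 1) < (v \<circ> ?s j' \<circ> ?s i) j'"
        and a1: "(v \<circ> ?s j' \<circ> ?s i \<circ> ?s j') i < (v \<circ> ?s j' \<circ> ?s i \<circ> ?s j') (i + 1)"
        and a2: "(v \<circ> ?s j' \<circ> ?s i \<circ> ?s j' \<circ> ?s i) j' < (v \<circ> ?s j' \<circ> ?s i \<circ> ?s j' \<circ> ?s i) (j' + 1)" for j'
    proof -
      have v1': "v1 = v \<circ> ?s j'" using v1_eq simple_gen_cong[OF j'] by simp
      have x': "x = ?e j' a x1" using x elem_step_cong[OF j'] by simp
      from IH[OF d1[folded v1']] obtain k1 b x2 where
        2: "k0 = Suc k1" "0 < b" "asc_cell n k1 (v1 \<circ> ?s i) x2" "x1 = ?e i b x2" by blast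
      have "k1 < k" using asc_step(1) 2(1) by simp
      from less.IH[OF this 2(3) d2[folded v1']] obtain k2 c x3 where
        3: "k1 = Suc k2" "0 < c" "asc_cell n k2 (v1 \<circ> ?s i \<circ> ?s j') x3" "x2 = ?e j' c x3" by blast
      have a: "0 < a" using asc_step by simp
      define A B C where "A = b * c / (a + c)" "B = a + c" "C = a * b / (a + c)"
      have pos: "0 < A" "0 < B" "0 < C" using a 2(2) 3(2) by (simp_all add: A_B_C_def)
      have "asc_cell n (Suc k2) (v1 \<circ> ?s i \<circ> ?s j' \<circ> ?s i) (?e i C x3)"
        using 3(3) a1 pos(3) unfolding v1' by (rule asc_cell.asc_step)
      then have "asc_cell n (Suc (Suc k2)) (v1 \<circ> ?s i \<circ> ?s j' \<circ> ?s i \<circ> ?s j') (?e j' B (?e i C x3))"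
        using a2 pos(2) unfolding v1' by (rule asc_cell.asc_step)
      moreover have "v1 \<circ> ?s i \<circ> ?s j' \<circ> ?s i \<circ> ?s j' = v \<circ> ?s i"
      proof -
        have "v1 \<circ> ?s i \<circ> ?s j' \<circ> ?s i \<circ> ?s j' = v \<circ> (?s j' \<circ> ?s i \<circ> ?s j') \<circ> ?s i \<circ> ?s j'"
          unfolding v1' by (simp only: comp_assoc)
        also have "\<dots> = v \<circ> ?s i \<circ> ?s j' \<circ> ?s i \<circ> ?s i \<circ> ?s j'"
          unfolding comm by (simp only: comp_assoc)
        also have "\<dots> = v \<circ> ?s i" by (simp only: comp_simple_gen_cancel[OF n])
        finally show ?thesis .
      qed
      moreover have "x = ?e i A (?e j' B (?e i C x3))"
        unfolding x' 2(4) 3(4) A_B_C_def using el[OF a 2(2) 3(2)] .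
      ultimately show ?thesis
        using pos(1) asc_step(1) 2(1) 3(1) by metis
    qed
    consider "j = i" | "j = i + 1" "n \<ge> 3" | "j = i + 1" "n = 2" | "j = i + int n - 1" "n \<ge> 3"
      | "i + 1 < j" "j + 1 < i + int n"
      using j n by linarith
    then show ?thesis
    proof cases
      case 1
      then have "asc_cell n k0 (v \<circ> ?s i) x1" using asc_step(4) v1_eq by simp
      then show ?thesis using asc_step x 1 by blast
    next
      case 2
      have fx: "?s (i + 1) i = i" "?s i (i + 2) = i + 2" "?s (i + 1) (i + 1) = i + 2" "?s (i + 1) (i + 2) = i + 1"
        using simple_gen_fix_below[of "i + 1" i n] simple_gen_fix_above[of i "i + 2" n]
          simple_gen_left[of n "i + 1"] simple_gen_right[OF n, of "i + 1"] 2 by (simp_all add: add.assoc)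
      have [simp]: "i + 1 + 1 = i + 2" by simp
      show ?thesis
        by (rule braid[of "i + 1"])
          (use 2 simple_gen_braid[OF 2(2), of i] elem_step_braid(2)[OF 2(2), of _ _ _ i] fx less.prems(2) desc_j n in \<open>simp_all add: comp_def\<close>)
    next
      case 3
      \<comment> \<open>Descents at i and at i + 1 would force v (i + 2) < v i.\<close>
      then have "v (i + 1 + 1) = v i + 2"
        using affine_sym_shift[OF asc_cell_affine_sym[OF n less.prems(1)], of i 1] by (simp add: algebra_simps)
      then show ?thesis using less.prems(2) desc_j unfolding 3(1) by linarith
    next
      case 4
      \<comment> \<open>The last letter is replaced by the congruent i - 1, so that the braid
        relation concerns consecutive integers.\<close>
      have j1: "(i - 1) mod int n = j mod int n" 
      proof -
        have "j = i - 1 + int n" using 4 by simp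
        then show ?thesis by (simp only: mod_add_self2)
      qed
      have d: "v i < v (i - 1)"
        using desc_j affine_sym_shift[OF asc_cell_affine_sym[OF n less.prems(1)], of "i - 1" 1]
          affine_sym_shift[OF asc_cell_affine_sym[OF n less.prems(1)], of i 1] 4 by (simp add: algebra_simps)
      have fx: "?s (i - 1) (i + 1) = i + 1" "?s i (i - 1) = i - 1" "?s (i - 1) (i - 1) = i" "?s (i - 1) i = i - 1"
        using simple_gen_fix_above[of "i - 1" "i + 1" n] simple_gen_fix_below[of i "i - 1" n]
          simple_gen_left[of n "i - 1"] simple_gen_right[OF n, of "i - 1"] 4 by simp_all
      show ?thesis
        by (rule braid[OF j1])
          (use simple_gen_braid[OF 4(2), of "i - 1"] elem_step_braid(1)[OF 4(2), of _ _ _ "i - 1"] fx less.prems(2) d n in \<open>simp_all add: comp_def\<close>)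
    next
      case 5
      have fx: "?s j i = i" "?s j (i + 1) = i + 1" "?s i j = j" "?s i (j + 1) = j + 1"
        using simple_gen_fix_below[of j i n] simple_gen_fix_below[of j "i + 1" n]
          simple_gen_fix_above[of i j n] simple_gen_fix_above[of i "j + 1" n] 5 by auto
      have "v1 (i + 1) < v1 i" using less.prems(2) by (simp add: v1_eq fx)
      from IH[OF this] obtain k1 b x2 where
        2: "k0 = Suc k1" "0 < b" "asc_cell n k1 (v1 \<circ> ?s i) x2" "x1 = ?e i b x2" by blast
      have "asc_cell n (Suc k1) (v1 \<circ> ?s i \<circ> ?s j) (?e j a x2)"
        using 2(3) by (rule asc_cell.asc_step) (use asc_j asc_step fx in auto)
      moreover have "v1 \<circ> ?s i \<circ> ?s j = v \<circ> ?s i"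
        unfolding v using simple_gen_commute[OF n 5] by (simp only: comp_assoc)
      moreover have "x = ?e i b (?e j a x2)"
        unfolding x 2(4)
        by (rule elem_step_commute)
          (use add_mod_neq[of "i + int n - (j + 1)" n "j + 1"] add_mod_neq[of "j - (i + 1)" n "i + 1"] 5 in \<open>auto simp: mod_simps\<close>)
      ultimately show ?thesis using 2 asc_step(1) by metis
    qed
  qed
qed

text \<open>The last letter of the first chain is a descent of v, so \<open>asc_cell_descent\<close>
  removes it from the second chain as well; x and y may be unrelated points.\<close>

lemma asc_cell_length_unique:
  assumes n: "n \<ge> 2" and "asc_cell n k v x" "asc_cell n m v y"
  shows "k = m"
  using assms(2,3)
proof (induction k arbitrary: v x m y)
  case 0
  from 0(1) have "v = id" by cases auto
  from 0(2) show ?case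
  proof cases
    case (asc_step m' u z i a)
    have "v (i + 1) < v i" using asc_step n by simp
    then show ?thesis using \<open>v = id\<close> by simp
  qed auto
next
  case (Suc k)
  from Suc.prems(1) show ?case
  proof cases
    case (asc_step u z i a)
    have "v (i + 1) < v i" using asc_step n by simp
    from asc_cell_descent[OF n Suc.prems(2) this] obtain m' y' where
      m: "m = Suc m'" "asc_cell n m' (v \<circ> simple_gen n i) y'" by blast
    have "v \<circ> simple_gen n i = u" using asc_step comp_simple_gen_cancel[OF n] by simp
    then show ?thesis using Suc.IH[OF asc_step(3)] m by simp
  qed
qed

section \<open>Words and lengths\<close>

lemma foldr_comp_append: "foldr (\<circ>) (fs @ gs) id = foldr (\<circ>) fs id \<circ> foldr (\<circ>) gs id"
  by (induction fs) (simp_all add: comp_assoc)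

lemma is_word_append: "is_word n v is \<Longrightarrow> is_word n u js \<Longrightarrow> is_word n (v \<circ> u) (is @ js)"
  by (simp add: is_word_def foldr_comp_append del: foldr_append)

lemma is_word_Nil: "is_word n v [] \<longleftrightarrow> v = id"
  by (auto simp: is_word_def)

lemma is_word_single: "i \<in> {0..<int n} \<Longrightarrow> is_word n (simple_gen n i) [i]"
  by (simp add: is_word_def)

lemma is_word_snocE:
  assumes "is_word n v (is @ [i])"
  obtains u where "i \<in> {0..<int n}" "is_word n u is" "v = u \<circ> simple_gen n i"
  using assms that by (auto simp: is_word_def foldr_comp_append simp del: foldr_append)

text \<open>An ascent is appended to the chain, while a descent cancels a letter. Chains therefore
  bound the lengths of arbitrary words from below.\<close>

lemma is_word_asc_cell:
  assumes n: "n \<ge> 2"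
  shows "is_word n v is \<Longrightarrow> \<exists>k x. k \<le> length is \<and> asc_cell n k v x"
proof (induction "is" arbitrary: v rule: rev_induct)
  case Nil
  then show ?case using asc_id unfolding is_word_Nil by blast
next
  case (snoc i "is")
  then obtain u where u: "is_word n u is" "v = u \<circ> simple_gen n i" by (elim is_word_snocE)
  from snoc.IH[OF u(1)] obtain k x where k: "k \<le> length is" "asc_cell n k u x" by blast
  from asc_cell_not_eq[OF n k(2), of i] show ?case
  proof
    assume "u i < u (i + 1)"
    \<comment> \<open>Only the existence of a point matters; the parameter 1 is an arbitrary
      positive choice.\<close>
    then have "asc_cell n (Suc k) v (elem_step n i 1 x)" unfolding u(2) by (rule asc_step[OF k(2)]) simp
    moreover have "Suc k \<le> length (is @ [i])" using k(1) by simp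
    ultimately show ?thesis by blast
  next
    assume "u (i + 1) < u i"
    from asc_cell_descent[OF n k(2) this] obtain k' x' where "k = Suc k'" "asc_cell n k' v x'"
      unfolding u(2) by blast
    moreover then have "k' \<le> length (is @ [i])" using k(1) by simp
    ultimately show ?thesis by blast
  qed
qed

lemma asc_cell_is_word:
  assumes n: "n \<ge> 2" and "asc_cell n k v x"
  shows "\<exists>is as. is_word n v is \<and> length is = k \<and> length as = k \<and> (\<forall>a\<in>set as. 0 < a) \<and>
    unfolding_of n (chevalley_word n is as) = x"
  using assms(2)
proof induction
  case asc_id
  then show ?case using n by (intro exI[of _ "[]"]) (auto simp: is_word_Nil unfolding_one fun_eq_iff)
next
  case (asc_step k v x i a)
  then obtain "is" as where w: "is_word n v is" "length is = k" "length as = k" "\<forall>a\<in>set as. 0 < a"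
    "unfolding_of n (chevalley_word n is as) = x" by blast
  have i: "i mod int n \<in> {0..<int n}" "simple_gen n (i mod int n) = simple_gen n i"
    "elem_step n (i mod int n) = elem_step n i"
    using n by (auto intro!: simple_gen_cong elem_step_cong)
  show ?case
  proof (intro exI conjI)
    show "is_word n (v \<circ> simple_gen n i) (is @ [i mod int n])"
      using is_word_append[OF w(1) is_word_single[OF i(1)]] unfolding i(2) .
    show "unfolding_of n (chevalley_word n (is @ [i mod int n]) (as @ [a])) = elem_step n i a x"
      unfolding i(3)[symmetric] using w n
      by (intro ext) (simp add: chevalley_word_snoc unfolding_mult_chevalley unitri_chevalley_word elem_step_def)
  qed (use w asc_step.hyps in auto)
qed

lemma aff_length_le: "is_word n v is \<Longrightarrow> aff_length n v \<le> length is"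
  unfolding aff_length_def by (rule Least_le) blast

lemma aff_length_asc_cell:
  assumes n: "n \<ge> 2" and "asc_cell n k v x"
  shows "aff_length n v = k"
  unfolding aff_length_def
proof (rule Least_equality)
  show "\<exists>is. is_word n v is \<and> length is = k" using asc_cell_is_word[OF assms] by blast
  show "k \<le> l" if "\<exists>is. is_word n v is \<and> length is = l" for l
    using that is_word_asc_cell[OF n] asc_cell_length_unique[OF n assms(2)] by blast
qed

text \<open>If the last letter were a descent of u, it would cancel, and v would be reached by a
  chain shorter than its length.\<close>

lemma reduced_word_snocE:
  assumes n: "n \<ge> 2" and red: "reduced_word n v (is @ [i])"
  obtains u where "reduced_word n u is" "v = u \<circ> simple_gen n i" "u i < u (i + 1)"
proof -
  from red obtain u where u: "is_word n u is" "v = u \<circ> simple_gen n i"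
    unfolding reduced_word_def by (blast elim: is_word_snocE)
  have len: "aff_length n v = Suc (length is)" using red by (simp add: reduced_word_def)
  obtain k y where k: "k \<le> length is" "asc_cell n k u y" using is_word_asc_cell[OF n u(1)] by blast
  have up: "u i < u (i + 1)"
  proof (rule ccontr)
    assume "\<not> u i < u (i + 1)"
    then have "u (i + 1) < u i" using asc_cell_not_eq[OF n k(2), of i] by simp
    from asc_cell_descent[OF n k(2) this] obtain k' y' where
      "k = Suc k'" "asc_cell n k' v y'" unfolding u(2) by blast
    then show False using aff_length_asc_cell[OF n, of k' v y'] len k(1) by simp
  qed
  have "asc_cell n (Suc k) v (elem_step n i 1 y)" unfolding u(2) by (rule asc_step[OF k(2) up]) simp
  then have "aff_length n v = Suc k" by (rule aff_length_asc_cell[OF n])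
  then have "reduced_word n u is" using len u(1) aff_length_asc_cell[OF n k(2)] by (simp add: reduced_word_def)
  with u(2) up that show thesis by blast
qed

lemma reduced_word_asc_cell:
  assumes n: "n \<ge> 2" and "reduced_word n v is" "length as = length is" "\<forall>a\<in>set as. 0 < a"
  shows "asc_cell n (length is) v (unfolding_of n (chevalley_word n is as))"
  using assms(2-)
proof (induction "is" arbitrary: v as rule: rev_induct)
  case Nil
  then have "v = id" by (simp add: reduced_word_def is_word_Nil)
  moreover have "unfolding_of n (chevalley_word n [] as) = (\<lambda>p q. if p = q then 1 else 0)"
    using n by (simp add: unfolding_one fun_eq_iff)
  ultimately show ?case using asc_id by (simp only: list.size)
next
  case (snoc i "is")
  obtain bs a where as: "as = bs @ [a]" using snoc.prems(2) by (cases as rule: rev_cases) auto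
  from snoc.prems(1) obtain u where u: "reduced_word n u is" "v = u \<circ> simple_gen n i" and up: "u i < u (i + 1)"
    by (rule reduced_word_snocE[OF n])
  have "length bs = length is" "\<forall>a\<in>set bs. 0 < a" and a: "0 < a" using snoc.prems as by auto
  from snoc.IH[OF u(1) this(1,2)]
  have "asc_cell n (Suc (length is)) v (elem_step n i a (unfolding_of n (chevalley_word n is bs)))"
    unfolding u(2) using up a by (rule asc_step)
  moreover have "elem_step n i a (unfolding_of n (chevalley_word n is bs)) = unfolding_of n (chevalley_word n (is @ [i]) as)"
    using n snoc.prems(2) as
    by (intro ext) (simp add: chevalley_word_snoc unfolding_mult_chevalley unitri_chevalley_word elem_step_def)
  ultimately show ?case by (simp only: length_append list.size) simp
qed

text \<open>Reduced words are the words of chains of ascents: all their letters are ascents, and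
  conversely the word of a chain has length k, which is \<open>aff_length n v\<close>.\<close>

lemma cell_iff_asc_cell:
  assumes n: "n \<ge> 2"
  shows "X \<in> cell n v \<longleftrightarrow> X \<in> unitri n \<and> (\<exists>k. asc_cell n k v (unfolding_of n X))"
proof
  assume "X \<in> cell n v"
  then obtain "is" as where w: "reduced_word n v is" "as \<in> pos_tuples (length is)" "X = chevalley_word n is as"
    by (auto simp: cell_def)
  then show "X \<in> unitri n \<and> (\<exists>k. asc_cell n k v (unfolding_of n X))"
    using reduced_word_asc_cell[OF n w(1), of as] unitri_chevalley_word[OF n, of "is" as]
    by (auto simp: pos_tuples_def)
next
  assume X: "X \<in> unitri n \<and> (\<exists>k. asc_cell n k v (unfolding_of n X))"
  then obtain k where k: "asc_cell n k v (unfolding_of n X)" by blast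
  from asc_cell_is_word[OF n k] obtain "is" as where w: "is_word n v is" "length is = k" "length as = k"
    "\<forall>a\<in>set as. 0 < a" "unfolding_of n (chevalley_word n is as) = unfolding_of n X" by blast
  have "chevalley_word n is as = X"
    using w unitri_chevalley_word[OF n, of "is" as] X by (intro unfolding_inject[of _ n]) (auto intro: unitri_carrier)
  then show "X \<in> cell n v"
    using w aff_length_asc_cell[OF n k] by (auto simp: cell_def reduced_word_def pos_tuples_def)
qed

text \<open>An ascent extends the chain. At a descent the current point can be rewritten to end in
  the same generator, and the parameters add up, so the permutation and the counter stay as they
  are. Only ascents enter \<open>us\<close>, which makes the counter grow by
  \<open>length us\<close>.\<close>

lemma asc_cell_mult_word:
  assumes n: "n \<ge> 2" and X: "X \<in> unitri n" "asc_cell n k v (unfolding_of n X)"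
    and w: "set js \<subseteq> {0..<int n}" "length js = length bs" "\<forall>b\<in>set bs. 0 < b"
  shows "\<exists>u us. is_word n u us \<and> asc_cell n (k + length us) (v \<circ> u) (unfolding_of n (X * chevalley_word n js bs))"
  using w
proof (induction js arbitrary: bs rule: rev_induct)
  case Nil
  then show ?case using X unitri_carrier[OF X(1)] by (intro exI[of _ id] exI[of _ "[]"]) (auto simp: is_word_Nil)
next
  case (snoc j js)
  obtain cs b where bs: "bs = cs @ [b]" using snoc.prems(2) by (cases bs rule: rev_cases) auto
  have len: "length js = length cs" using snoc.prems bs by simp
  have "set js \<subseteq> {0..<int n}" "\<forall>b\<in>set cs. 0 < b" using snoc.prems bs by auto
  from snoc.IH[OF this(1) len this(2)] obtain u us where
    u: "is_word n u us" "asc_cell n (k + length us) (v \<circ> u) (unfolding_of n (X * chevalley_word n js cs))" by blast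
  let ?W = "chevalley_word n js cs"
  have XW: "X * ?W \<in> unitri n" using X n len by (auto intro: unitri_mult unitri_chevalley_word)
  have "X * chevalley_word n (js @ [j]) bs = (X * ?W) * chevalley n j b"
    using unitri_carrier[OF X(1)] unitri_carrier[OF unitri_chevalley_word[OF n len]] chevalley_carrier[of n j b] n len
    by (simp add: bs chevalley_word_snoc assoc_mult_mat[of _ n n _ n _ n])
  then have step: "unfolding_of n (X * chevalley_word n (js @ [j]) bs) = elem_step n j b (unfolding_of n (X * ?W))"
    using n XW by (auto simp: unfolding_mult_chevalley elem_step_def fun_eq_iff)
  have b: "0 < b" and j: "j \<in> {0..<int n}" using snoc.prems bs by auto
  from asc_cell_not_eq[OF n u(2), of j] show ?case
  proof
    assume up: "(v \<circ> u) j < (v \<circ> u) (j + 1)"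
    show ?thesis
    proof (intro exI conjI)
      show "is_word n (u \<circ> simple_gen n j) (us @ [j])"
        by (rule is_word_append[OF u(1) is_word_single[OF j]])
      show "asc_cell n (k + length (us @ [j])) (v \<circ> (u \<circ> simple_gen n j)) (unfolding_of n (X * chevalley_word n (js @ [j]) bs))"
        using asc_step[OF u(2) up b] unfolding step
        by (simp only: comp_assoc length_append list.size add_Suc_right add_0_right)
    qed
  next
    assume down: "(v \<circ> u) (j + 1) < (v \<circ> u) j"
    from asc_cell_descent[OF n u(2) down] obtain k' c y where
      y: "k + length us = Suc k'" "0 < c" "asc_cell n k' (v \<circ> u \<circ> simple_gen n j) y"
        "unfolding_of n (X * ?W) = elem_step n j c y" by blast
    have "(v \<circ> u \<circ> simple_gen n j) j < (v \<circ> u \<circ> simple_gen n j) (j + 1)"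
      using down n by simp
    from asc_step[OF y(3) this, of "b + c"]
    have "asc_cell n (k + length us) (v \<circ> u) (unfolding_of n (X * chevalley_word n (js @ [j]) bs))"
      using y b by (simp only: step y(4) elem_step_add[OF n] comp_simple_gen_cancel[OF n])
    then show ?thesis using u(1) by blast
  qed
qed

section \<open>Injectivity of the parametrization\<close>

lemma elem_step_cancel:
  assumes n: "n \<ge> 2" and x: "asc_cell n k u x" "asc_cell n m u x'" and up: "u i < u (i + 1)"
    and eq: "elem_step n i a x = elem_step n i a' x'"
  shows "a = a' \<and> x = x'"
proof -
  have shift: "x = elem_step n i (a' - a) x'" if "elem_step n i a x = elem_step n i a' x'" for a a' x x'
  proof -
    have "x = elem_step n i (- a) (elem_step n i a x)"
      unfolding elem_step_add[OF n] by (simp add: elem_step_def fun_eq_iff)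
    also have "\<dots> = elem_step n i (a' - a) x'" unfolding that elem_step_add[OF n] by simp
    finally show ?thesis .
  qed
  have no: "\<not> a < a'" if "asc_cell n k u x" "asc_cell n m u x'" "elem_step n i a x = elem_step n i a' x'" for k m a a' x x'
  proof
    assume "a < a'"
    then have "asc_cell n (Suc m) (u \<circ> simple_gen n i) (elem_step n i (a' - a) x')"
      using asc_step[OF that(2) up] by simp
    then have "asc_cell n (Suc m) (u \<circ> simple_gen n i) x" unfolding shift[OF that(3), symmetric] .
    then have "u \<circ> simple_gen n i = u" using asc_cell_disjoint[OF n _ that(1)] by blast
    then have "u (simple_gen n i i) = u i" by (metis comp_apply)
    with up show False by simp
  qed
  have "a = a'" using no[OF x eq] no[OF x(2,1) eq[symmetric]] by simp
  moreover have "x = elem_step n i 0 x'" using shift[OF eq] \<open>a = a'\<close> by simp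
  then have "x = x'" by (simp add: elem_step_def fun_eq_iff)
  ultimately show ?thesis by simp
qed

lemma inj_on_chevalley_word:
  assumes n: "n \<ge> 2" and "reduced_word n v is"
  shows "inj_on (chevalley_word n is) (pos_tuples (length is))"
  using assms(2)
proof (induction "is" arbitrary: v rule: rev_induct)
  case Nil
  show ?case by (auto simp: inj_on_def pos_tuples_def)
next
  case (snoc i "is")
  from snoc.prems obtain u where u: "reduced_word n u is" and up: "u i < u (i + 1)"
    by (rule reduced_word_snocE[OF n])
  show ?case
  proof (rule inj_onI)
    fix as as' assume *: "as \<in> pos_tuples (length (is @ [i]))" "as' \<in> pos_tuples (length (is @ [i]))"
      "chevalley_word n (is @ [i]) as = chevalley_word n (is @ [i]) as'"
    obtain bs a where as: "as = bs @ [a]" using *(1) by (cases as rule: rev_cases) (auto simp: pos_tuples_def)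
    obtain bs' a' where as': "as' = bs' @ [a']" using *(2) by (cases as' rule: rev_cases) (auto simp: pos_tuples_def)
    have bs: "length bs = length is" "length bs' = length is" "\<forall>b\<in>set bs. 0 < b" "\<forall>b\<in>set bs'. 0 < b"
      using * as as' by (auto simp: pos_tuples_def)
    let ?x = "\<lambda>bs. unfolding_of n (chevalley_word n is bs)"
    have step: "unfolding_of n (chevalley_word n (is @ [i]) (bs @ [a])) = elem_step n i a (?x bs)"
      if "length bs = length is" for bs a
      using n that
      by (intro ext) (simp add: chevalley_word_snoc unfolding_mult_chevalley unitri_chevalley_word elem_step_def)
    have "elem_step n i a (?x bs) = elem_step n i a' (?x bs')"
      using *(3) step[OF bs(1), of a] step[OF bs(2), of a'] unfolding as as' by simp
    from elem_step_cancel[OF n reduced_word_asc_cell[OF n u bs(1,3)] reduced_word_asc_cell[OF n u bs(2,4)] up this]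
    have "a = a'" "?x bs = ?x bs'" by auto
    have "chevalley_word n is bs = chevalley_word n is bs'"
      by (rule unfolding_inject[OF _ _ \<open>?x bs = ?x bs'\<close>])
        (auto intro!: unitri_carrier unitri_chevalley_word[OF n] simp: bs)
    then have "bs = bs'"
      using inj_onD[OF snoc.IH[OF u]] bs by (auto simp: pos_tuples_def)
    then show "as = as'" using as as' \<open>a = a'\<close> by simp
  qed
qed

theorem theorem3p6:
  fixes n l :: nat and w :: "int \<Rightarrow> int"
  assumes "n \<ge> 2" and "w \<in> affine_sym n" and "aff_length n w = l"
  shows "(\<forall>is. reduced_word n w is \<longrightarrow>
            chevalley_word n is \<in> pos_tuples l \<rightarrow> cell n w \<and>
            inj_on (chevalley_word n is) (pos_tuples l)) \<and>
         (\<forall>X Y Z. X \<in> cell n w \<longrightarrow>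
            Y \<in> loop_U n \<longrightarrow> totally_nonneg n Y \<longrightarrow>
            Z \<in> loop_U n \<longrightarrow> totally_nonneg n Z \<longrightarrow> X = Y * Z \<longrightarrow>
            (\<exists>v \<in> affine_sym n. \<exists>u \<in> affine_sym n.
               Y \<in> cell n v \<and> Z \<in> cell n u \<and> right_weak_le n v w))"
proof (intro conjI allI impI)
  note n = assms(1)
  fix "is" assume red: "reduced_word n w is"
  then have l: "length is = l" using assms(3) by (simp add: reduced_word_def)
  show "chevalley_word n is \<in> pos_tuples l \<rightarrow> cell n w"
    using red l unfolding cell_def by blast
  show "inj_on (chevalley_word n is) (pos_tuples l)"
    using inj_on_chevalley_word[OF n red] l by simp
next
  note n = assms(1)
  have n0: "n > 0" using n by simp
  fix X Y Z
  assume X: "X \<in> cell n w" and "Y \<in> loop_U n" "totally_nonneg n Y" "Z \<in> loop_U n" "totally_nonneg n Z"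
    and X_eq: "X = Y * Z"
  then have Y: "Y \<in> unitri n" "tnn (unfolding_of n Y)" and Z: "Z \<in> unitri n" "tnn (unfolding_of n Z)"
    by (auto simp: loop_U_def loop_GL_def unitri_def totally_nonneg_def tnn_def)
  from X obtain "is" as where w: "length as = length is" "X = chevalley_word n is as"
    by (auto simp: cell_def pos_tuples_def)
  from X obtain k where k: "asc_cell n k w (unfolding_of n X)"
    using cell_iff_asc_cell[OF n] by blast
  have "banded (unfolding_of n X)" using banded_chevalley_word[OF n] w by simp
  then obtain b where b: "\<And>i j. i + b < j \<Longrightarrow> unfolding_of n X i j = 0" unfolding banded_def by blast
  have X_sum: "unfolding_of n X i j = (\<Sum>k\<in>{i..j}. unfolding_of n Y i k * unfolding_of n Z k j)" for i j
    unfolding X_eq by (rule unfolding_mult[OF n0 Y(1) Z(1)])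
  have term_le: "unfolding_of n Y i k * unfolding_of n Z k j \<le> unfolding_of n X i j" if "i \<le> k" "k \<le> j" for i j k
    unfolding X_sum using that tnn_nonneg[OF Y(2)] tnn_nonneg[OF Z(2)] by (intro member_le_sum) auto
  have diag: "unfolding_of n Y i i = 1" "unfolding_of n Z i i = 1"
    "j < i \<Longrightarrow> unfolding_of n Y i j = 0" "j < i \<Longrightarrow> unfolding_of n Z i j = 0" for i j
    using Y Z by (auto simp: unitri_def)
  \<comment> \<open>Taking k = j and k = i in \<open>term_le\<close>, the unit diagonals bound the
    entries of Y and Z by the entry of X, which is 0 here.\<close>
  have "unfolding_of n Y i j = 0 \<and> unfolding_of n Z i j = 0" if "i + b < j" for i j
  proof (cases "j < i")
    case False
    then show ?thesis
      using term_le[of i j j] term_le[of i i j] b[OF that] diag tnn_nonneg[OF Y(2), of i j] tnn_nonneg[OF Z(2), of i j]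
      by simp
  qed (simp add: diag)
  then have banded: "banded (unfolding_of n Y)" "banded (unfolding_of n Z)"
    unfolding banded_def by blast+
  from chevalley_word_inverse[OF n, of "is" as] w obtain W where
    W: "W \<in> unitri n" "banded (unfolding_of n W)" "X * W = 1\<^sub>m n" by auto
  have car: "Y \<in> carrier_mat n n" "Z \<in> carrier_mat n n" "W \<in> carrier_mat n n" "X \<in> carrier_mat n n"
    using Y Z W unfolding X_eq by (auto intro!: unitri_carrier unitri_mult[OF n0])
  have WX: "W * X = 1\<^sub>m n" using mat_mult_left_right_inverse[OF car(4,3) W(3)] .
  \<comment> \<open>The inverse of Y is \<open>Z * W\<close>, a product of banded matrices; likewise
    \<open>W * Y\<close> is the inverse of Z.\<close>
  have "Y * (Z * W) = 1\<^sub>m n"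
    using W(3) car unfolding X_eq by (simp add: assoc_mult_mat[of _ n n _ n _ n])
  then have "(Z * W) * Y = 1\<^sub>m n" using mat_mult_left_right_inverse[of Y n "Z * W"] car by simp
  then obtain js bs where Yw: "set js \<subseteq> {0..<int n}" "length js = length bs" "\<forall>b\<in>set bs. 0 < b" "Y = chevalley_word n js bs"
    using tnn_banded_factorization[OF n Y banded(1) unitri_mult[OF n0 Z(1) W(1)] banded_mult[OF n0 Z(1) W(1) banded(2) W(2)]]
    by blast
  have "(W * Y) * Z = 1\<^sub>m n"
    using WX car unfolding X_eq by (simp add: assoc_mult_mat[of _ n n _ n _ n])
  then obtain js' bs' where Zw: "set js' \<subseteq> {0..<int n}" "length js' = length bs'" "\<forall>b\<in>set bs'. 0 < b" "Z = chevalley_word n js' bs'"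
    using tnn_banded_factorization[OF n Z banded(2) unitri_mult[OF n0 W(1) Y(1)] banded_mult[OF n0 W(1) Y(1) W(2) banded(1)]]
    by blast
  have one: "asc_cell n 0 id (unfolding_of n (1\<^sub>m n))"
  proof -
    have "unfolding_of n (1\<^sub>m n) = (\<lambda>p q. if p = q then 1 else 0)" using n0 by (intro ext unfolding_one)
    then show ?thesis using asc_id by (simp only:)
  qed
  have ex: "\<exists>m v. asc_cell n m v (unfolding_of n (chevalley_word n js bs))"
    if "set js \<subseteq> {0..<int n}" "length js = length bs" "\<forall>b\<in>set bs. 0 < b" for js bs
    using asc_cell_mult_word[OF n unitri_one[OF n0] one that] unitri_carrier[OF unitri_chevalley_word[OF n that(2)]]
    by auto
  obtain m v where v: "asc_cell n m v (unfolding_of n Y)" using ex[OF Yw(1-3)] unfolding Yw(4) by blast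
  obtain m' u where u: "asc_cell n m' u (unfolding_of n Z)" using ex[OF Zw(1-3)] unfolding Zw(4) by blast
  obtain t ts where t: "is_word n t ts" "asc_cell n (m + length ts) (v \<circ> t) (unfolding_of n X)"
    using asc_cell_mult_word[OF n Y(1) v Zw(1-3)] unfolding X_eq Zw(4) by blast
  have w_eq: "w = v \<circ> t" using asc_cell_disjoint[OF n k t(2)] .
  \<comment> \<open>The word \<open>ts\<close> is not yet known to be reduced. Since w has length m
    + \<open>length ts\<close> but also a word of length m + m2 with m2 at most
    \<open>length ts\<close>, equality holds and lengths add.\<close>
  obtain m2 z where m2: "m2 \<le> length ts" "asc_cell n m2 t z" using is_word_asc_cell[OF n t(1)] by blast
  obtain vs where vs: "is_word n v vs" "length vs = m" using asc_cell_is_word[OF n v] by blast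
  obtain us where us: "is_word n t us" "length us = m2" using asc_cell_is_word[OF n m2(2)] by blast
  have "aff_length n w = m + length ts" using aff_length_asc_cell[OF n t(2)] w_eq by simp
  moreover have "aff_length n w \<le> m + m2"
    using aff_length_le[OF is_word_append[OF vs(1) us(1)]] vs us w_eq by simp
  ultimately have "aff_length n w = aff_length n v + aff_length n t"
    using m2(1) aff_length_asc_cell[OF n v] aff_length_asc_cell[OF n m2(2)] by simp
  then have "right_weak_le n v w"
    using w_eq asc_cell_affine_sym[OF n v] asc_cell_affine_sym[OF n m2(2)] assms(2)
    unfolding right_weak_le_def by blast
  moreover have "Y \<in> cell n v" "Z \<in> cell n u"
    using cell_iff_asc_cell[OF n] Y Z v u by blast+
  ultimately show "\<exists>v \<in> affine_sym n. \<exists>u \<in> affine_sym n. Y \<in> cell n v \<and> Z \<in> cell n u \<and> right_weak_le n v w"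
    using asc_cell_affine_sym[OF n v] asc_cell_affine_sym[OF n u] by blast
qed

end
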